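(* Let $\mu_0\in\mathbb{R}$, let $g_0\in\mathcal{G}_{\mathrm{loc}}$, and consider the location model $g(x;\mu)=g_0(x-\mu)$, $\mu\in\mathbb{R}$. For $f_0\in\mathcal{F}_{\mathrm{loc}}(g_0;\mu_0)$ define $$\mathcal{T}_{\mu_0;\mathrm{loc}}(f_0,g_0):\mathbb{R}\to\mathbb{R}:\ x\mapsto \frac{-\partial_y\big(f_0(y-\mu_0)g_0(y-\mu_0)\big)\big|_{y=x}}{g_0(x-\mu_0)},$$ with $\partial_y$ the derivative in the sense of distributions with respect to $y$. Let $Z_{\mu}$ have Lebesgue density $g(\cdot;\mu)$ and let $X$ be a random variable taking values in $\mathbb{R}$. Then: (1) If $X\stackrel{\mathcal{D}}{=}Z_{\mu_0}$, then $\mathrm{E}[\mathcal{T}_{\mu_0;\mathrm{loc}}(f_0,g_0)(X)]=0$ for all $f_0\in\mathcal{F}_{\mathrm{loc}}(g_0;\mu_0)$. (2) If the support $S$ of $g(\cdot;\mu)$ does not depend on $\mu$ and if $\mathrm{E}[\mathcal{T}_{\mu_0;\mathrm{loc}}(f_0,g_0)(X)]=0$ for all $f_0\in\mathcal{F}_{\mathrm{loc}}(g_0;\mu_0)$, then $X\,|\,X\in S\stackrel{\mathcal{D}}{=}Z_{\mu_0}$.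
   Context: The dominating measure is Lebesgue measure on $\mathbb{R}$ and the parameter space is $\Theta=\mathbb{R}$. The support of a density is the set where it is strictly positive; $1/g_0(x-\mu_0)=0$ by convention outside the support of $g_0(\cdot-\mu_0)$. $\mathcal{G}(\mathbb{R},\mu_0)$ is the collection of measurable $g:\mathbb{R}\times\Theta\to\mathbb{R}^+$ with $\int g(x;\mu)\,dx=1$ for all $\mu\in\Theta$, for which there exist a bounded neighborhood $\Theta_0\subset\Theta$ of $\mu_0$ and an integrable $h:\mathbb{R}\to\mathbb{R}^+$ with $g(x;\mu)\le h(x)$ for all $x\in\mathbb{R}$, $\mu\in\Theta_0$. $\mathcal{G}_{\mathrm{loc}}$ is the collection of positive functions $g_0$ integrating to $1$ over their support for which $g(x;\mu)=g_0(x-\mu)$ belongs to $\mathcal{G}(\mathbb{R},\mu_0)$. For $g_0\in\mathcal{G}_{\mathrm{loc}}$, $\mathcal{F}_{\mathrm{loc}}(g_0;\mu_0)$ is the collection of all $f_0:\mathbb{R}\to\mathbb{R}$ such that (i) $\int_{\mathbb{R}}f_0(x-\mu)g_0(x-\mu)\,dx=\int_{\mathbb{R}}f_0(x)g_0(x)\,dx=c_{f_0}$ is a finite constant; (ii) the mapping $x\mapsto f_0(x)g_0(x)$ is differentiable in the sense of distributions; (iii) there exists an integrable function $h$ such that $\big|\partial_y(f_0(y-\mu)g_0(y-\mu))|_{y=x}\big|\le h(x)$ over $\mathbb{R}$ for all $\mu\in\Theta_0$, some bounded neighborhood of $\mu_0$. $\stackrel{\mathcal{D}}{=}$ is equality in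 law, and $X\,|\,X\in S$ refers to the conditional law of $X$ given $X\in S$. *)

theory Defs
  imports "HOL-Probability.Probability"
begin

definition dens_support :: "(real \<Rightarrow> real) \<Rightarrow> real set" where
  "dens_support p = {x. p x > 0}"

definition bounded_nbhd :: "real \<Rightarrow> real set \<Rightarrow> bool" where
  "bounded_nbhd \<mu>0 \<Theta>0 \<longleftrightarrow> bounded \<Theta>0 \<and> \<mu>0 \<in> interior \<Theta>0"

(* "Positive" means non-negative for densities: their supports may be proper subsets of the line. *)
definition G_dens :: "real \<Rightarrow> (real \<Rightarrow> real \<Rightarrow> real) set" where
  "G_dens \<mu>0 = {g.
     (\<lambda>(x, \<mu>). g x \<mu>) \<in> borel_measurable (borel \<Otimes>\<^sub>M borel) \<and>
     (\<forall>x \<mu>. 0 \<le> g x \<mu>) \<and>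
     (\<forall>\<mu>. has_bochner_integral lborel (\<lambda>x. g x \<mu>) 1) \<and>
     (\<exists>\<Theta>0 h. bounded_nbhd \<mu>0 \<Theta>0 \<and> integrable lborel h \<and> (\<forall>x. 0 \<le> h x) \<and>
        (\<forall>x. \<forall>\<mu>\<in>\<Theta>0. g x \<mu> \<le> h x))}"

definition loc_model :: "(real \<Rightarrow> real) \<Rightarrow> real \<Rightarrow> real \<Rightarrow> real" where
  "loc_model g0 x \<mu> = g0 (x - \<mu>)"

definition G_loc :: "real \<Rightarrow> (real \<Rightarrow> real) set" where
  "G_loc \<mu>0 = {g0.
     (\<forall>x. 0 \<le> g0 x) \<and>
     has_bochner_integral lborel (\<lambda>x. indicator (dens_support g0) x * g0 x) 1 \<and>
     loc_model g0 \<in> G_dens \<mu>0}"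

definition test_function :: "(real \<Rightarrow> real) \<Rightarrow> bool" where
  "test_function \<psi> \<longleftrightarrow>
     (\<forall>n x. ((deriv ^^ n) \<psi>) differentiable (at x)) \<and> compact (closure {x. \<psi> x \<noteq> 0})"

definition locally_integrable :: "(real \<Rightarrow> real) \<Rightarrow> bool" where
  "locally_integrable u \<longleftrightarrow> (\<forall>a b. set_integrable lborel {a..b} u)"

definition has_distr_deriv :: "(real \<Rightarrow> real) \<Rightarrow> (real \<Rightarrow> real) \<Rightarrow> bool" where
  "has_distr_deriv u d \<longleftrightarrow> locally_integrable u \<and> locally_integrable d \<and>
     (\<forall>\<psi>. test_function \<psi> \<longrightarrow>
        (LINT x|lborel. u x * deriv \<psi> x) = - (LINT x|lborel. d x * \<psi> x))"

(* A distributional derivative is determined only up to Lebesgue-null sets, whereas expectations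
   under an arbitrary law may see such sets.  The version fixed here is the classical derivative if
   u is differentiable everywhere with derivative representing the distributional one, and an
   arbitrary version otherwise. *)
definition distr_deriv :: "(real \<Rightarrow> real) \<Rightarrow> real \<Rightarrow> real" where
  "distr_deriv u =
     (if (\<forall>x. u differentiable (at x)) \<and> has_distr_deriv u (deriv u) then deriv u
      else (SOME d. has_distr_deriv u d))"

(* The bound on the derivative is almost everywhere because the derivative is a class of
   functions modulo null sets. *)
definition F_loc :: "(real \<Rightarrow> real) \<Rightarrow> real \<Rightarrow> (real \<Rightarrow> real) set" where
  "F_loc g0 \<mu>0 = {f0.
     (\<exists>c. \<forall>\<mu>. has_bochner_integral lborel (\<lambda>x. f0 (x - \<mu>) * g0 (x - \<mu>)) c) \<and>
     (\<exists>d. has_distr_deriv (\<lambda>x. f0 x * g0 x) d) \<and>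
     (\<exists>\<Theta>0 h. bounded_nbhd \<mu>0 \<Theta>0 \<and> integrable lborel h \<and>
        (\<forall>\<mu>\<in>\<Theta>0. AE x in lborel. \<bar>distr_deriv (\<lambda>y. f0 (y - \<mu>) * g0 (y - \<mu>)) x\<bar> \<le> h x))}"

(* Division by zero yields 0, which is the convention for 1 / g0 (x - \<mu>0) off the support. *)
definition T_loc :: "real \<Rightarrow> (real \<Rightarrow> real) \<Rightarrow> (real \<Rightarrow> real) \<Rightarrow> real \<Rightarrow> real" where
  "T_loc \<mu>0 f0 g0 x = - distr_deriv (\<lambda>y. f0 (y - \<mu>0) * g0 (y - \<mu>0)) x / g0 (x - \<mu>0)"

definition eq_law :: "'a measure \<Rightarrow> ('a \<Rightarrow> real) \<Rightarrow> 'b measure \<Rightarrow> ('b \<Rightarrow> real) \<Rightarrow> bool" where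
  "eq_law M X N Z \<longleftrightarrow> distr M borel X = distr N borel Z"

definition cond_measure :: "'a measure \<Rightarrow> ('a \<Rightarrow> real) \<Rightarrow> real set \<Rightarrow> 'a measure" where
  "cond_measure M X S = uniform_measure M {\<omega> \<in> space M. X \<omega> \<in> S}"

end

theory Submission
  imports Defs
begin

text \<open>
Write \<open>g\<close> for the density of the model at \<open>\<mu>0\<close> and \<open>u\<close> for the function \<open>f0 (x - \<mu>0) * g x\<close>, with
distributional derivative \<open>d\<close>. The operator is \<open>- d / g\<close>.

If \<open>X\<close> has density \<open>g\<close>, then its expectation is minus the integral of \<open>d\<close> over the support of \<open>g\<close>.
Two facts about a pair of integrable functions \<open>u\<close>, \<open>d\<close> make it vanish. First, the integral of
\<open>d\<close> over the line is \<open>0\<close> (\<open>integral_distr_deriv_zero\<close>). Second, \<open>d = 0\<close> almost everywhere on the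
zeros of \<open>u\<close>, in particular off the support of \<open>g\<close> (\<open>distr_deriv_zero_on_zeros\<close>). Both rest on
testing against smooth functions, which identifies \<open>u\<close> almost everywhere with the indefinite
Lebesgue integral \<open>D\<close> of \<open>d\<close> (\<open>distr_deriv_primitive\<close>). That an integrand vanishes on the zeros of
its indefinite integral usually follows from Lebesgue's differentiation theorem. Here it comes from
the chain rule for the polynomials \<open>s * (1 - s\<^sup>2) ^ n\<close>, which needs only Fubini: they tend to \<open>0\<close> on
\<open>[-1, 1]\<close>, while their derivatives tend boundedly to the indicator function of \<open>{0}\<close>
(\<open>integrand_zero_on_zeros\<close>).

Conversely, if the support does not depend on \<open>\<mu>\<close>, then it is invariant under translations, hence the
whole line, and conditioning on it changes nothing. For each continuous \<open>\<phi>\<close> with compact support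
and integral \<open>0\<close>, the choice \<open>f0 = F / g0\<close> with an antiderivative \<open>F\<close> of \<open>\<phi>\<close> is admissible and gives
the operator \<open>- \<phi> / g\<close>, up to a translation of \<open>\<phi>\<close> (\<open>antiderivative_quotient_in_F_loc\<close>). So the law
of \<open>X\<close> divided by \<open>g\<close> is a measure whose derivative is \<open>0\<close>, that is, a multiple of Lebesgue measure
(\<open>annihilates_derivatives_imp_multiple_of_lborel\<close>), and the law of \<open>X\<close> is that multiple of the
model. The factor is \<open>1\<close> since both have total mass \<open>1\<close>.
\<close>

section \<open>Smooth compactly supported functions\<close>

definition flat :: "nat \<Rightarrow> real \<Rightarrow> real" where
  "flat k x = (if 0 < x then inverse x ^ k * exp (- inverse x) else 0)"

text \<open>The derivative of \<open>x^(-k) exp (- 1 / x)\<close> is again a combination of two functions of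
this family, so the family carries its own smoothness proof. Only the origin needs an argument:
there, the difference quotient tends to \<open>0\<close> because exponentials beat powers.\<close>
lemma flat_has_derivative:
  "(flat k has_real_derivative (flat (k + 2) x - real k * flat (k + 1) x)) (at x)"
proof -
  consider "x > 0" | "x < 0" | "x = 0" by linarith
  then show ?thesis
  proof cases
    case 1
    have "((\<lambda>x. inverse x ^ k * exp (- inverse x)) has_real_derivative
            (flat (k + 2) x - real k * flat (k + 1) x)) (at x)"
    proof (cases k)
      case 0
      then show ?thesis
        using 1 by (auto intro!: derivative_eq_intros simp: flat_def power2_eq_square)
    next
      case (Suc m)
      have "((\<lambda>x. inverse x ^ Suc m * exp (- inverse x)) has_real_derivative
              ((1 + real m) * (- (inverse x ^ 2) * inverse x ^ m)) * exp (- inverse x) +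
              (exp (- inverse x) * inverse x ^ 2) * inverse x ^ Suc m) (at x)"
        using 1
        by (intro DERIV_mult DERIV_power_Suc) (auto intro!: derivative_eq_intros simp: power2_eq_square)
      moreover have "((1 + real m) * (- (inverse x ^ 2) * inverse x ^ m)) * exp (- inverse x) +
              (exp (- inverse x) * inverse x ^ 2) * inverse x ^ Suc m =
            flat (k + 2) x - real k * flat (k + 1) x"
        using 1 Suc by (simp add: flat_def power2_eq_square algebra_simps)
      ultimately show ?thesis using Suc by simp
    qed
    then show ?thesis
      by (rule has_field_derivative_transform_within_open[where S = "{0<..}"])
        (use 1 in \<open>auto simp: flat_def\<close>)
  next
    case 2
    have "((\<lambda>x. 0) has_real_derivative (flat (k + 2) x - real k * flat (k + 1) x)) (at x)"
      using 2 by (auto simp: flat_def)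
    then show ?thesis
      by (rule has_field_derivative_transform_within_open[where S = "{..<0}"])
        (use 2 in \<open>auto simp: flat_def\<close>)
  next
    case 3
    have "((\<lambda>y. y ^ Suc k / exp y) \<longlongrightarrow> (0::real)) at_top"
      by (rule tendsto_power_div_exp_0)
    then have "((\<lambda>h. inverse h ^ Suc k / exp (inverse h)) \<longlongrightarrow> (0::real)) (at_right 0)"
      by (rule filterlim_compose) (rule filterlim_inverse_at_top_right)
    moreover have "\<forall>\<^sub>F h in at_right 0. inverse h ^ Suc k / exp (inverse h) = flat k h / h"
      by (auto simp: eventually_at_filter flat_def exp_minus field_simps)
    ultimately have r: "((\<lambda>h. flat k h / h) \<longlongrightarrow> 0) (at_right 0)"
      by (rule Lim_transform_eventually)
    have "\<forall>\<^sub>F h in at_left 0. 0 = flat k h / h"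
      by (auto simp: eventually_at_filter flat_def)
    then have l: "((\<lambda>h. flat k h / h) \<longlongrightarrow> 0) (at_left 0)"
      by (rule Lim_transform_eventually[OF tendsto_const])
    have "((\<lambda>h. flat k h / h) \<longlongrightarrow> 0) (at 0)"
      using l r by (rule filterlim_split_at)
    then show ?thesis
      using 3 by (simp add: DERIV_def flat_def)
  qed
qed

text \<open>A class of functions in which every member has a derivative in the class consists of smooth
functions. Generating the class inductively turns smoothness of a composite function into the
application of introduction rules, without any formula for its higher derivatives. The rule
\<open>antiderivative\<close> admits indefinite integrals of members, which is how test functions with a
prescribed derivative arise below.\<close>
inductive built_smooth :: "(real \<Rightarrow> real) \<Rightarrow> bool" where
  flat: "built_smooth (flat k)"
| const: "built_smooth (\<lambda>x. c)"
| add: "built_smooth f \<Longrightarrow> built_smooth g \<Longrightarrow> built_smooth (\<lambda>x. f x + g x)"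
| mult: "built_smooth f \<Longrightarrow> built_smooth g \<Longrightarrow> built_smooth (\<lambda>x. f x * g x)"
| affine: "built_smooth f \<Longrightarrow> built_smooth (\<lambda>x. f (a + b * x))"
| antiderivative: "built_smooth f \<Longrightarrow> (\<And>x. (F has_real_derivative f x) (at x)) \<Longrightarrow> built_smooth F"

lemma built_smooth_derivative:
  "built_smooth f \<Longrightarrow> \<exists>f'. built_smooth f' \<and> (\<forall>x. (f has_real_derivative f' x) (at x))"
proof (induction rule: built_smooth.induct)
  case (flat k)
  have "built_smooth (\<lambda>x. flat (k + 2) x + (- real k) * flat (k + 1) x)"
    by (intro built_smooth.add built_smooth.mult built_smooth.const built_smooth.flat)
  then show ?case
    using flat_has_derivative[of k] by (intro exI conjI) auto
next
  case (const c)
  show ?case by (rule exI[of _ "\<lambda>x. 0"]) (auto intro: built_smooth.const)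
next
  case (add f g)
  then obtain f' g' where "built_smooth f'" "built_smooth g'"
    "\<And>x. (f has_real_derivative f' x) (at x)" "\<And>x. (g has_real_derivative g' x) (at x)"
    by blast
  then show ?case
    by (intro exI[of _ "\<lambda>x. f' x + g' x"]) (auto intro: built_smooth.add DERIV_add)
next
  case (mult f g)
  then obtain f' g' where "built_smooth f'" "built_smooth g'"
    "\<And>x. (f has_real_derivative f' x) (at x)" "\<And>x. (g has_real_derivative g' x) (at x)"
    by blast
  then show ?case using mult.hyps
    by (intro exI[of _ "\<lambda>x. f' x * g x + g' x * f x"] conjI allI built_smooth.add built_smooth.mult DERIV_mult) auto
next
  case (affine f a b)
  then obtain f' where f': "built_smooth f'" "\<And>x. (f has_real_derivative f' x) (at x)"
    by blast
  have "((\<lambda>x. f (a + b * x)) has_real_derivative b * f' (a + b * x)) (at x)" for x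
    by (rule DERIV_cong[OF DERIV_chain2[OF f'(2)]]) (auto intro!: derivative_eq_intros)
  then show ?case
    using f' by (intro exI[of _ "\<lambda>x. b * f' (a + b * x)"] conjI allI
        built_smooth.mult built_smooth.const built_smooth.affine) auto
next
  case (antiderivative f F)
  then show ?case by auto
qed

lemma built_smooth_test_function:
  assumes "built_smooth \<psi>" and "\<And>x. x \<notin> {a..b} \<Longrightarrow> \<psi> x = 0"
  shows "test_function \<psi>"
proof -
  have "built_smooth ((deriv ^^ n) \<psi>)" for n
  proof (induction n)
    case (Suc n)
    then obtain f' where "built_smooth f'"
      "\<And>x. ((deriv ^^ n) \<psi> has_real_derivative f' x) (at x)"
      using built_smooth_derivative by blast
    then show ?case
      by (metis DERIV_imp_deriv ext funpow.simps(2) o_apply)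
  qed (use assms in simp)
  then have "((deriv ^^ n) \<psi>) differentiable (at x)" for n x
    using built_smooth_derivative real_differentiable_def by blast
  moreover have "compact (closure {x. \<psi> x \<noteq> 0})"
  proof -
    have "{x. \<psi> x \<noteq> 0} \<subseteq> {a..b}" using assms(2) by blast
    then show ?thesis
      by (meson bounded_closed_interval bounded_subset compact_closure)
  qed
  ultimately show ?thesis by (simp add: test_function_def)
qed

text \<open>A smooth approximation from below of the indicator function of \<open>(a, b)\<close>. No plateau is needed:
the factor \<open>flat 0\<close> increases to \<open>1\<close> at infinity, so rescaling its argument is enough.\<close>
definition bump :: "real \<Rightarrow> real \<Rightarrow> nat \<Rightarrow> real \<Rightarrow> real" where
  "bump a b n x = flat 0 (real (Suc n) * (x - a)) * flat 0 (real (Suc n) * (b - x))"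

lemma flat_0_bounds: "0 \<le> flat 0 x" "flat 0 x \<le> 1"
  by (auto simp: flat_def)

lemma bump_bounds: "0 \<le> bump a b n x" "bump a b n x \<le> 1"
  using flat_0_bounds by (auto simp: bump_def intro!: mult_le_one mult_nonneg_nonneg)

lemma bump_pos: "x \<in> {a<..<b} \<Longrightarrow> 0 < bump a b n x"
  by (auto simp: bump_def flat_def)

lemma bump_outside: "x \<notin> {a<..<b} \<Longrightarrow> bump a b n x = 0"
  by (auto simp: bump_def flat_def zero_less_mult_iff)

lemma built_smooth_bump: "built_smooth (bump a b n)"
proof -
  have "built_smooth (\<lambda>x. flat 0 (- real (Suc n) * a + real (Suc n) * x) *
          flat 0 (real (Suc n) * b + (- real (Suc n)) * x))"
    by (intro built_smooth.mult built_smooth.affine built_smooth.flat)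
  moreover have "(\<lambda>x. flat 0 (- real (Suc n) * a + real (Suc n) * x) *
          flat 0 (real (Suc n) * b + (- real (Suc n)) * x)) = bump a b n"
    unfolding bump_def by (simp add: algebra_simps del: of_nat_Suc)
  ultimately show ?thesis by simp
qed

lemma bump_tendsto_indicator: "(\<lambda>n. bump a b n x) \<longlonglongrightarrow> indicator {a<..<b} x"
proof (cases "x \<in> {a<..<b}")
  case True
  have *: "(\<lambda>n. flat 0 (real (Suc n) * t)) \<longlonglongrightarrow> 1" if "t > 0" for t
  proof -
    have "(\<lambda>n. exp (- (inverse (real (Suc n)) * inverse t))) \<longlonglongrightarrow> exp (- (0 * inverse t))"
      by (intro tendsto_intros LIMSEQ_inverse_real_of_nat)
    then show ?thesis using that by (simp add: flat_def del: of_nat_Suc)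
  qed
  show ?thesis
    using tendsto_mult[OF *[of "x - a"] *[of "b - x"]] True by (simp add: bump_def del: of_nat_Suc)
qed (simp add: bump_outside)

lemma built_smooth_continuous: "built_smooth f \<Longrightarrow> continuous_on UNIV f"
  using built_smooth_derivative by (meson DERIV_continuous_on has_field_derivative_at_within)

section \<open>Indefinite Lebesgue integrals\<close>

definition integral_upto :: "(real \<Rightarrow> real) \<Rightarrow> real \<Rightarrow> real" where
  "integral_upto f x = (LINT y|lborel. indicator {..x} y * f y)"

lemma integral_upto_measurable [measurable]:
  assumes [measurable]: "f \<in> borel_measurable borel"
  shows "integral_upto f \<in> borel_measurable borel"
proof -
  have "(\<lambda>x. LINT y|lborel. (if y \<le> x then 1 else 0) * f y) \<in> borel_measurable borel"
    by measurable
  then show ?thesis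
    by (simp add: integral_upto_def[abs_def] indicator_def)
qed

lemma integrable_mult_bounded:
  fixes f g :: "real \<Rightarrow> real"
  assumes "integrable lborel f" "g \<in> borel_measurable borel" "\<And>x. \<bar>g x\<bar> \<le> C"
  shows "integrable lborel (\<lambda>x. g x * f x)"
proof (rule Bochner_Integration.integrable_bound[where f = "\<lambda>x. C * f x"])
  show "AE x in lborel. norm (g x * f x) \<le> norm (C * f x)"
  proof (rule AE_I2)
    fix x
    have "\<bar>g x\<bar> \<le> \<bar>C\<bar>" using assms(3)[of x] by linarith
    then show "norm (g x * f x) \<le> norm (C * f x)"
      by (simp add: abs_mult mult_right_mono)
  qed
qed (use assms in \<open>auto simp: borel_measurable_integrable\<close>)

lemma integrable_indicator_mult:
  fixes f :: "real \<Rightarrow> real"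
  assumes "integrable lborel f" "A \<in> sets borel"
  shows "integrable lborel (\<lambda>x. indicator A x * f x)"
  by (rule integrable_mult_bounded[where C = 1]) (use assms in \<open>auto simp: indicator_def\<close>)

lemma abs_integral_upto_le:
  assumes "integrable lborel f"
  shows "\<bar>integral_upto f x\<bar> \<le> (LINT y|lborel. \<bar>f y\<bar>)"
proof -
  have "\<bar>integral_upto f x\<bar> \<le> (LINT y|lborel. \<bar>indicator {..x} y * f y\<bar>)"
    unfolding integral_upto_def by (rule integral_abs_bound)
  also have "\<dots> \<le> (LINT y|lborel. \<bar>f y\<bar>)"
  proof (rule integral_mono)
    show "integrable lborel (\<lambda>y. \<bar>indicator {..x} y * f y\<bar>)"
      by (intro integrable_abs integrable_indicator_mult assms) auto
  qed (use assms in \<open>auto simp: indicator_def\<close>)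
  finally show ?thesis .
qed

lemma integral_upto_diff:
  assumes "integrable lborel f" "integrable lborel g"
  shows "integral_upto (\<lambda>x. f x - g x) x = integral_upto f x - integral_upto g x"
  using assms unfolding integral_upto_def
  by (subst Bochner_Integration.integral_diff[symmetric])
    (auto simp: right_diff_distrib distrib_left intro!: integrable_indicator_mult)

lemma integral_upto_add:
  assumes "integrable lborel f" "integrable lborel g"
  shows "integral_upto (\<lambda>x. f x + g x) x = integral_upto f x + integral_upto g x"
  using assms unfolding integral_upto_def
  by (subst Bochner_Integration.integral_add[symmetric])
    (auto simp: right_diff_distrib distrib_left intro!: integrable_indicator_mult)

lemma integrable_mult_integral_upto:
  assumes "integrable lborel f" "integrable lborel g"
  shows "integrable lborel (\<lambda>x. integral_upto f x * g x)"
  by (rule integrable_mult_bounded[OF assms(2) _ abs_integral_upto_le[OF assms(1)]])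
    (use assms in \<open>auto dest: borel_measurable_integrable\<close>)

text \<open>By Fubini, the product of the two integrals is the integral of \<open>f x * g y\<close> over the plane, which
the diagonal splits into the halves \<open>y \<le> x\<close> and \<open>x < y\<close>. The diagonal itself is a null set.
This is integration by parts for absolutely continuous functions, without any differentiation.\<close>
lemma integral_by_parts:
  assumes f: "integrable lborel f" and g: "integrable lborel g"
  shows "(LINT x|lborel. integral_upto g x * f x) + (LINT x|lborel. integral_upto f x * g x) =
         (LINT x|lborel. f x) * (LINT x|lborel. g x)"
proof -
  have [measurable]: "f \<in> borel_measurable borel" "g \<in> borel_measurable borel"
    using f g by auto
  let ?le = "\<lambda>(x :: real) (y :: real). (if y \<le> x then 1 else 0 :: real)"
  have fg: "integrable (lborel \<Otimes>\<^sub>M lborel) (\<lambda>(x, y). f x * g y)"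
    using f g by (intro lborel_pair.Fubini_integrable) (auto simp: abs_mult)
  have le: "integrable (lborel \<Otimes>\<^sub>M lborel) (\<lambda>(x, y). ?le x y * (f x * g y))"
    by (rule Bochner_Integration.integrable_bound[OF fg]) auto
  have gt: "integrable (lborel \<Otimes>\<^sub>M lborel) (\<lambda>(x, y). (1 - ?le x y) * (f x * g y))"
    by (rule Bochner_Integration.integrable_bound[OF fg]) auto
  have "(LINT x|lborel. f x) * (LINT x|lborel. g x) = (LINT x|lborel. LINT y|lborel. f x * g y)"
    by simp
  also have "\<dots> = integral\<^sup>L (lborel \<Otimes>\<^sub>M lborel) (\<lambda>(x, y). f x * g y)"
    using lborel_pair.integral_fst'[OF fg] by simp
  also have "\<dots> = integral\<^sup>L (lborel \<Otimes>\<^sub>M lborel) (\<lambda>z. (\<lambda>(x, y). ?le x y * (f x * g y)) z +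
                     (\<lambda>(x, y). (1 - ?le x y) * (f x * g y)) z)"
    by (rule Bochner_Integration.integral_cong) (auto split: prod.splits)
  also have "\<dots> = integral\<^sup>L (lborel \<Otimes>\<^sub>M lborel) (\<lambda>(x, y). ?le x y * (f x * g y)) +
                  integral\<^sup>L (lborel \<Otimes>\<^sub>M lborel) (\<lambda>(x, y). (1 - ?le x y) * (f x * g y))"
    by (rule Bochner_Integration.integral_add[OF le gt])
  also have "integral\<^sup>L (lborel \<Otimes>\<^sub>M lborel) (\<lambda>(x, y). ?le x y * (f x * g y)) =
             (LINT x|lborel. LINT y|lborel. ?le x y * (f x * g y))"
    using lborel_pair.integral_fst'[OF le] by simp
  also have "\<dots> = (LINT x|lborel. integral_upto g x * f x)"
  proof (rule Bochner_Integration.integral_cong[OF refl])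
    fix x
    have "(LINT y|lborel. ?le x y * (f x * g y)) = (LINT y|lborel. f x * (indicator {..x} y * g y))"
      by (rule Bochner_Integration.integral_cong) (auto simp: indicator_def)
    then show "(LINT y|lborel. ?le x y * (f x * g y)) = integral_upto g x * f x"
      by (simp add: integral_upto_def)
  qed
  also have "integral\<^sup>L (lborel \<Otimes>\<^sub>M lborel) (\<lambda>(x, y). (1 - ?le x y) * (f x * g y)) =
             (LINT y|lborel. LINT x|lborel. (1 - ?le x y) * (f x * g y))"
    using lborel_pair.integral_snd[OF gt] by simp
  also have "\<dots> = (LINT x|lborel. integral_upto f x * g x)"
  proof (rule Bochner_Integration.integral_cong[OF refl])
    fix y :: real
    have "AE x in lborel. x \<noteq> y" by (rule AE_lborel_singleton)
    then have "AE x in lborel. (1 - ?le x y) * (f x * g y) = g y * (indicator {..y} x * f x)"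
      by eventually_elim (auto simp: indicator_def)
    then have "(LINT x|lborel. (1 - ?le x y) * (f x * g y)) =
               (LINT x|lborel. g y * (indicator {..y} x * f x))"
      by (intro integral_cong_AE) auto
    then show "(LINT x|lborel. (1 - ?le x y) * (f x * g y)) = integral_upto f y * g y"
      by (simp add: integral_upto_def)
  qed
  finally show ?thesis by simp
qed

text \<open>The product rule for indefinite integrals: integration by parts for the two integrands cut off
at \<open>x\<close>.\<close>
lemma integral_upto_mult:
  assumes f: "integrable lborel f" and g: "integrable lborel g"
  shows "integral_upto (\<lambda>x. integral_upto g x * f x + integral_upto f x * g x) x =
         integral_upto f x * integral_upto g x"
proof -
  let ?r = "\<lambda>(f :: real \<Rightarrow> real) y. indicator {..x} y * f y"
  have rr: "?r (integral_upto (?r h)) y = ?r (integral_upto h) y" for h y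
    by (auto simp: integral_upto_def indicator_def intro!: Bochner_Integration.integral_cong)
  have r: "integrable lborel (?r f)" "integrable lborel (?r g)"
    using f g by (auto intro: integrable_indicator_mult)
  have eq: "integral_upto (?r h) y * ?r k y = ?r (\<lambda>y. integral_upto h y * k y) y" for h k y
    using rr[where h = h and y = y] by (auto simp: indicator_def)
  have "integral_upto (\<lambda>x. integral_upto g x * f x + integral_upto f x * g x) x =
    integral_upto (\<lambda>x. integral_upto g x * f x) x + integral_upto (\<lambda>x. integral_upto f x * g x) x"
    by (intro integral_upto_add integrable_mult_integral_upto f g)
  also have "\<dots> = integral_upto f x * integral_upto g x"
    using integral_by_parts[OF r] unfolding eq by (simp add: integral_upto_def)
  finally show ?thesis .
qed

lemma integral_upto_tendsto:
  assumes "integrable lborel f"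
  shows "(\<lambda>n. integral_upto f (real n)) \<longlonglongrightarrow> (LINT x|lborel. f x)"
  unfolding integral_upto_def
proof (rule integral_dominated_convergence[where w = "\<lambda>x. \<bar>f x\<bar>"])
  show "AE x in lborel. (\<lambda>n. indicator {..real n} x * f x) \<longlonglongrightarrow> f x"
  proof (rule AE_I2)
    fix x
    obtain N where "x \<le> real N" using real_arch_simple by blast
    then have "\<forall>\<^sub>F n in sequentially. f x = indicator {..real n} x * f x"
      by (auto simp: eventually_sequentially indicator_def intro!: exI[of _ N])
    then show "(\<lambda>n. indicator {..real n} x * f x) \<longlonglongrightarrow> f x"
      by (rule Lim_transform_eventually[OF tendsto_const])
  qed
qed (use assms in \<open>auto simp: indicator_def\<close>)

text \<open>The half-lines are closed under intersection and generate the Borel sets, so \<open>f\<close> has integral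
\<open>0\<close> over every Borel set, by Dynkin's \<open>\<pi>\<close>-\<open>\<lambda>\<close> theorem.\<close>
lemma integral_upto_zero_imp_AE_zero:
  assumes f: "integrable lborel f" and "\<And>x. integral_upto f x = 0"
  shows "AE x in lborel. f x = 0"
proof -
  have int: "set_integrable lborel A f" if "A \<in> sets borel" for A
    using f that by (auto simp: set_integrable_def intro: integrable_indicator_mult)
  have total: "(LINT x|lborel. f x) = 0"
    using integral_upto_tendsto[OF f] assms(2) by (simp add: LIMSEQ_const_iff)
  have "(LINT x:A|lborel. f x) = 0" if "A \<in> sets borel" for A
  proof -
    have "Int_stable (range (\<lambda>a::real. {..a}))" by (auto simp: Int_stable_def)
    moreover have "range (\<lambda>a::real. {..a}) \<subseteq> Pow UNIV" by auto
    moreover have "A \<in> sigma_sets UNIV (range (\<lambda>a::real. {..a}))"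
      using that unfolding borel_eq_atMost by simp
    ultimately show ?thesis
    proof (induction rule: sigma_sets_induct_disjoint)
      case (basic A)
      then show ?case
        using assms(2) by (auto simp: set_lebesgue_integral_def integral_upto_def)
    next
      case empty
      then show ?case by (simp add: set_lebesgue_integral_def)
    next
      case (compl A)
      then have A: "A \<in> sets borel" unfolding borel_eq_atMost by simp
      have "(LINT x:UNIV - A|lborel. f x) = (LINT x|lborel. f x - indicator A x * f x)"
        unfolding set_lebesgue_integral_def
        by (rule Bochner_Integration.integral_cong) (auto simp: indicator_def)
      also have "\<dots> = (LINT x|lborel. f x) - (LINT x:A|lborel. f x)"
        using integrable_indicator_mult[OF f A] f
        by (simp add: set_lebesgue_integral_def)
      finally show ?case using compl total by simp
    next
      case (union A)
      then have A: "A i \<in> sets borel" for i unfolding borel_eq_atMost by auto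
      have "(LINT x:(\<Union>i. A i)|lborel. f x) = (\<Sum>i. (LINT x:(A i)|lborel. f x))"
        using union(1) A
        by (intro lebesgue_integral_countable_add) (auto simp: disjoint_family_on_def intro!: int)
      then show ?case using union by simp
    qed
  qed
  then show ?thesis
    by (intro density_unique_real f) auto
qed

lemma interval_integrals_zero_imp_AE_zero:
  fixes w :: "real \<Rightarrow> real"
  assumes int: "\<And>a b. integrable lborel (\<lambda>x. indicator {a<..<b} x * w x)"
    and zero: "\<And>a b. a < b \<Longrightarrow> (LINT x|lborel. indicator {a<..<b} x * w x) = 0"
  shows "AE x in lborel. w x = 0"
proof -
  have "AE x in lborel. indicator {-real k<..<real k} x * w x = 0" for k :: nat
  proof (rule integral_upto_zero_imp_AE_zero[OF int])
    fix x :: real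
    let ?m = "min x (real k)"
    have "AE y in lborel. y \<noteq> x" by (rule AE_lborel_singleton)
    then have AE: "AE y in lborel. indicator {..x} y * (indicator {-real k<..<real k} y * w y) =
                           indicator {-real k<..<?m} y * w y"
      by eventually_elim (auto simp: indicator_def)
    have "integral_upto (\<lambda>x. indicator {-real k<..<real k} x * w x) x =
          (LINT y|lborel. indicator {-real k<..<?m} y * w y)"
      unfolding integral_upto_def
      by (intro integral_cong_AE AE borel_measurable_integrable integrable_indicator_mult int) auto
    also have "\<dots> = 0"
      using zero[of "- real k" ?m] by (cases "- real k < ?m") auto
    finally show "integral_upto (\<lambda>x. indicator {-real k<..<real k} x * w x) x = 0" .
  qed
  then have "AE x in lborel. \<forall>k. indicator {-real k<..<real k} x * w x = 0"
    unfolding AE_all_countable by blast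
  then show ?thesis
  proof eventually_elim
    case (elim x)
    obtain k :: nat where "\<bar>x\<bar> < real k" using reals_Archimedean2 by blast
    then show ?case using elim[rule_format, of k] by (auto simp: indicator_def split: if_splits)
  qed
qed

section \<open>The integrand vanishes almost everywhere on the zeros of its indefinite integral\<close>

text \<open>The expression is the derivative of \<open>s * (1 - s\<^sup>2) ^ (n + 1)\<close>. With \<open>t = s\<^sup>2\<close>, its second part
is twice \<open>(n + 1) * t * (1 - t) ^ n\<close>, the probability of a single success in \<open>n + 1\<close> trials with
success probability \<open>t\<close>, hence at most \<open>2\<close>.\<close>
lemma power_one_minus_square_bound:
  assumes "\<bar>s\<bar> \<le> (1::real)"
  shows "\<bar>(1 - s\<^sup>2) ^ Suc n - 2 * real (Suc n) * s\<^sup>2 * (1 - s\<^sup>2) ^ n\<bar> \<le> 3"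
proof -
  define t where "t = s\<^sup>2"
  have t: "0 \<le> t" "t \<le> 1" using assms by (auto simp: t_def abs_square_le_1)
  have p: "0 \<le> (1 - t) ^ n" "0 \<le> (1 - t) ^ Suc n" "(1 - t) ^ Suc n \<le> 1"
    using t by (auto intro!: power_le_one simp del: power_Suc)
  have "real (Suc n) * t \<le> 1 + real n * t" using t by (simp add: algebra_simps)
  also have "\<dots> \<le> (1 + t) ^ n" using t by (intro Bernoulli_inequality) auto
  finally have "real (Suc n) * t * (1 - t) ^ n \<le> (1 + t) ^ n * (1 - t) ^ n"
    using p by (intro mult_right_mono) auto
  also have "\<dots> = (1 - t\<^sup>2) ^ n"
    by (simp add: power_mult_distrib[symmetric] algebra_simps power2_eq_square)
  also have "\<dots> \<le> 1" using t by (intro power_le_one) (auto simp: power_le_one)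
  finally have "real (Suc n) * t * (1 - t) ^ n \<le> 1" .
  moreover have "0 \<le> real (Suc n) * t * (1 - t) ^ n" using t p by simp
  ultimately have "\<bar>(1 - t) ^ Suc n - 2 * (real (Suc n) * t * (1 - t) ^ n)\<bar> \<le> 3"
    using p by linarith
  then show ?thesis unfolding t_def mult.assoc .
qed

lemma power_one_minus_square_tendsto:
  assumes "\<bar>s\<bar> \<le> (1::real)"
  shows "(\<lambda>n. (1 - s\<^sup>2) ^ Suc n - 2 * real (Suc n) * s\<^sup>2 * (1 - s\<^sup>2) ^ n)
           \<longlonglongrightarrow> (if s = 0 then 1 else 0)"
proof (cases "s = 0")
  case False
  define r where "r = 1 - s\<^sup>2"
  have r: "\<bar>r\<bar> < 1" using assms False by (auto simp: r_def abs_square_le_1 abs_less_iff)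
  have "(\<lambda>n. r ^ n) \<longlonglongrightarrow> 0" using r by (simp add: LIMSEQ_power_zero)
  moreover have "(\<lambda>n. real n * r ^ n) \<longlonglongrightarrow> 0"
    using powser_times_n_limit_0[of r] r by simp
  ultimately have "(\<lambda>n. r * r ^ n - 2 * s\<^sup>2 * (real n * r ^ n + r ^ n)) \<longlonglongrightarrow>
      r * 0 - 2 * s\<^sup>2 * (0 + 0)"
    by (intro tendsto_diff tendsto_mult tendsto_add tendsto_const)
  then show ?thesis using False by (simp add: r_def algebra_simps)
qed simp

text \<open>The chain rule for \<open>s * (1 - s\<^sup>2) ^ (n + 1)\<close> along \<open>D\<close>. The next power arises from the previous
one by subtracting its product with \<open>D\<^sup>2\<close>, so an induction needs the product rule for indefinite
integrals only, and no pointwise derivative of \<open>D\<close>.\<close>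
lemma integral_upto_power_one_minus_square:
  fixes d :: "real \<Rightarrow> real"
  defines "D \<equiv> integral_upto d"
  defines "e n x \<equiv> ((1 - (D x)\<^sup>2) ^ Suc n - 2 * real (Suc n) * (D x)\<^sup>2 * (1 - (D x)\<^sup>2) ^ n) * d x"
  assumes d: "integrable lborel d"
  shows "integrable lborel (e n) \<and> integral_upto (e n) = (\<lambda>x. D x * (1 - (D x)\<^sup>2) ^ Suc n)"
proof -
  \<comment> \<open>The integrand of \<open>A - A * D\<^sup>2\<close>, where \<open>A\<close> is the indefinite integral of \<open>a\<close>.\<close>
  define step where "step a x = a x - (integral_upto (\<lambda>x. D x * d x + D x * d x) x * a x +
      integral_upto a x * (D x * d x + D x * d x))" for a x
  have "integrable lborel (\<lambda>x. D x * d x)"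
    unfolding D_def by (rule integrable_mult_integral_upto[OF d d])
  then have sq1: "integrable lborel (\<lambda>x. D x * d x + D x * d x)"
    by (intro Bochner_Integration.integrable_add)
  have sq2: "integral_upto (\<lambda>x. D x * d x + D x * d x) = (\<lambda>x. (D x)\<^sup>2)"
    unfolding D_def power2_eq_square by (rule ext) (rule integral_upto_mult[OF d d])
  note sq = sq1 sq2
  have step: "integrable lborel (step a)"
     "integral_upto (step a) x = integral_upto a x - integral_upto a x * (D x)\<^sup>2"
    if a: "integrable lborel a" for a x
  proof -
    have i: "integrable lborel (\<lambda>x. integral_upto (\<lambda>x. D x * d x + D x * d x) x * a x)"
       "integrable lborel (\<lambda>x. integral_upto a x * (D x * d x + D x * d x))"
      by (intro integrable_mult_integral_upto a sq(1))+
    then show "integrable lborel (step a)"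
      unfolding step_def[abs_def] using a by (intro Bochner_Integration.integrable_diff Bochner_Integration.integrable_add)
    show "integral_upto (step a) x = integral_upto a x - integral_upto a x * (D x)\<^sup>2"
      unfolding step_def[abs_def]
      by (subst integral_upto_diff[OF a Bochner_Integration.integrable_add[OF i]],
          subst integral_upto_mult[OF a sq(1)], subst sq(2)) (rule refl)
  qed
  show ?thesis
  proof (induction n)
    case 0
    have "e 0 = step d"
      unfolding step_def sq(2) D_def[symmetric]
      by (rule ext) (simp add: e_def algebra_simps power2_eq_square)
    then show ?case
      using step[OF d] by (auto simp: D_def[symmetric] algebra_simps)
  next
    case (Suc n)
    have "e (Suc n) x = step (e n) x" for x
    proof -
      have E: "integral_upto (e n) x = D x * (1 - (D x)\<^sup>2) ^ Suc n" using Suc by simp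
      show ?thesis
        unfolding step_def sq(2) E by (simp add: e_def algebra_simps power2_eq_square)
    qed
    then have "e (Suc n) = step (e n)" by (rule ext)
    then show ?case
      using step[of "e n"] Suc by (auto simp: algebra_simps)
  qed
qed

text \<open>The functions \<open>s * (1 - s\<^sup>2) ^ (n + 1)\<close> tend to \<open>0\<close> on \<open>[-1, 1]\<close>, while their derivatives
stay bounded and tend to the indicator function of \<open>{0}\<close>. Passing to the limit in the chain rule
along \<open>D\<close> shows that \<open>d\<close>, restricted to the zeros of \<open>D\<close>, has indefinite integral \<open>0\<close>.\<close>
lemma integrand_zero_on_zeros_if_le_1:
  fixes d :: "real \<Rightarrow> real"
  defines "D \<equiv> integral_upto d"
  assumes d: "integrable lborel d" and D1: "\<And>x. \<bar>D x\<bar> \<le> 1"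
  shows "AE x in lborel. D x = 0 \<longrightarrow> d x = 0"
proof -
  have [measurable]: "d \<in> borel_measurable borel" using d by auto
  have [measurable]: "D \<in> borel_measurable borel" unfolding D_def by measurable
  let ?c = "\<lambda>n x. (1 - (D x)\<^sup>2) ^ Suc n - 2 * real (Suc n) * (D x)\<^sup>2 * (1 - (D x)\<^sup>2) ^ n"
  let ?z = "\<lambda>x. (if D x = 0 then 1 else 0) * d x"
  have "AE x in lborel. ?z x = 0"
  proof (rule integral_upto_zero_imp_AE_zero)
    show "integrable lborel ?z"
      by (rule integrable_mult_bounded[OF d, of _ 1]) auto
    fix x
    have "(\<lambda>n. integral_upto (\<lambda>x. ?c n x * d x) x) \<longlonglongrightarrow> integral_upto ?z x"
      unfolding integral_upto_def
    proof (rule integral_dominated_convergence[where w = "\<lambda>x. 3 * \<bar>d x\<bar>"])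
      show "AE y in lborel. (\<lambda>n. indicator {..x} y * (?c n y * d y)) \<longlonglongrightarrow> indicator {..x} y * ?z y"
        by (intro AE_I2 tendsto_mult tendsto_const power_one_minus_square_tendsto D1)
      show "AE y in lborel. norm (indicator {..x} y * (?c n y * d y)) \<le> 3 * \<bar>d y\<bar>" for n
      proof (rule AE_I2)
        fix y
        have "\<bar>?c n y * d y\<bar> \<le> 3 * \<bar>d y\<bar>"
          unfolding abs_mult by (intro mult_right_mono power_one_minus_square_bound D1) auto
        then show "norm (indicator {..x} y * (?c n y * d y)) \<le> 3 * \<bar>d y\<bar>"
          by (simp add: indicator_def del: power_Suc of_nat_Suc)
      qed
    qed (use d in auto)
    moreover have "(\<lambda>n. integral_upto (\<lambda>x. ?c n x * d x) x) \<longlonglongrightarrow> 0"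
    proof -
      have "integral_upto (\<lambda>x. ?c n x * d x) x = D x * (1 - (D x)\<^sup>2) ^ Suc n" for n
        using integral_upto_power_one_minus_square[OF d, of n] by (simp add: D_def)
      moreover have "(\<lambda>n. D x * (1 - (D x)\<^sup>2) ^ Suc n) \<longlonglongrightarrow> 0"
      proof (cases "D x = 0")
        case False
        then have "\<bar>1 - (D x)\<^sup>2\<bar> < 1"
          using D1[of x] by (auto simp: abs_square_le_1 abs_less_iff)
        then have "(\<lambda>n. (1 - (D x)\<^sup>2) ^ n) \<longlonglongrightarrow> 0" by (simp add: LIMSEQ_power_zero)
        then have "(\<lambda>n. D x * (1 - (D x)\<^sup>2) ^ Suc n) \<longlonglongrightarrow> D x * 0"
          by (rule tendsto_mult[OF tendsto_const LIMSEQ_Suc])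
        then show ?thesis by simp
      qed simp
      ultimately show ?thesis by (simp del: power_Suc)
    qed
    ultimately show "integral_upto ?z x = 0" by (rule LIMSEQ_unique)
  qed
  then show ?thesis by eventually_elim auto
qed

text \<open>The bound \<open>1\<close> on the indefinite integral is reached by scaling with the \<open>L\<^sup>1\<close> norm of the
integrand, increased by \<open>1\<close> to make it positive.\<close>
lemma integrand_zero_on_zeros:
  assumes d: "integrable lborel d"
  shows "AE x in lborel. integral_upto d x = 0 \<longrightarrow> d x = 0"
proof -
  define K where "K = (LINT y|lborel. \<bar>d y\<bar>) + 1"
  have K: "K > 0" unfolding K_def by (intro add_nonneg_pos integral_nonneg_AE) auto
  have s: "integral_upto (\<lambda>x. inverse K * d x) x = inverse K * integral_upto d x" for x
    unfolding integral_upto_def by (simp add: mult.left_commute)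
  have "AE x in lborel. integral_upto (\<lambda>x. inverse K * d x) x = 0 \<longrightarrow> inverse K * d x = 0"
  proof (rule integrand_zero_on_zeros_if_le_1)
    show "\<bar>integral_upto (\<lambda>x. inverse K * d x) x\<bar> \<le> 1" for x
    proof -
      have "\<bar>integral_upto d x\<bar> \<le> K" using abs_integral_upto_le[OF d, of x] by (simp add: K_def)
      then show ?thesis using K unfolding s abs_mult by (simp add: field_simps)
    qed
  qed (use d in auto)
  then show ?thesis using K by (simp add: s)
qed

section \<open>Continuous functions with compact support\<close>
lemma integrable_continuous_compact_support:
  fixes \<phi> :: "real \<Rightarrow> real"
  assumes "continuous_on UNIV \<phi>" "\<And>x. x \<notin> {a<..<b} \<Longrightarrow> \<phi> x = 0"
  shows "integrable lborel \<phi>"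
proof -
  have "set_integrable lborel {a..b} \<phi>"
    using assms(1) continuous_on_subset by (intro borel_integrable_atLeastAtMost') blast
  moreover have "(\<lambda>x. indicator {a..b} x *\<^sub>R \<phi> x) = \<phi>"
  proof
    show "indicator {a..b} x *\<^sub>R \<phi> x = \<phi> x" for x
      using assms(2)[of x] by (cases "x \<in> {a<..<b}") auto
  qed
  ultimately show ?thesis by (simp add: set_integrable_def)
qed

lemma bounded_continuous_compact_support:
  fixes \<phi> :: "real \<Rightarrow> real"
  assumes "continuous_on UNIV \<phi>" "\<And>x. x \<notin> {a<..<b} \<Longrightarrow> \<phi> x = 0"
  obtains C where "0 \<le> C" "\<And>x. \<bar>\<phi> x\<bar> \<le> C"
proof -
  have "compact (\<phi> ` {a..b})"
    using assms(1) by (intro compact_continuous_image) (auto intro: continuous_on_subset)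
  then obtain C where "\<forall>y\<in>\<phi> ` {a..b}. norm y \<le> C"
    using compact_imp_bounded bounded_iff by blast
  then have C: "\<bar>\<phi> x\<bar> \<le> C" if "x \<in> {a..b}" for x
    using that by auto
  show thesis
  proof
    show "\<bar>\<phi> x\<bar> \<le> max C 0" for x
      using C[of x] assms(2)[of x] by (cases "x \<in> {a<..<b}") auto
  qed auto
qed

lemma integral_upto_below_support:
  assumes "\<And>x. x \<notin> {a<..<b} \<Longrightarrow> \<phi> x = 0" "x \<le> a"
  shows "integral_upto \<phi> x = 0"
proof -
  have "(\<lambda>y. indicator {..x} y * \<phi> y) = (\<lambda>y. 0)"
  proof
    show "indicator {..x} y * \<phi> y = 0" for y
      using assms(1)[of y] assms(2) by (cases "y \<in> {a<..<b}") auto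
  qed
  then show ?thesis unfolding integral_upto_def by simp
qed

lemma integral_upto_above_support:
  assumes "\<And>x. x \<notin> {a<..<b} \<Longrightarrow> \<phi> x = 0" "b \<le> x"
  shows "integral_upto \<phi> x = (LINT y|lborel. \<phi> y)"
proof -
  have "(\<lambda>y. indicator {..x} y * \<phi> y) = \<phi>"
  proof
    show "indicator {..x} y * \<phi> y = \<phi> y" for y
      using assms(1)[of y] assms(2) by (cases "y \<in> {a<..<b}") auto
  qed
  then show ?thesis unfolding integral_upto_def by simp
qed

lemma integral_upto_has_derivative:
  assumes cont: "continuous_on UNIV \<phi>" and supp: "\<And>x. x \<notin> {a<..<b} \<Longrightarrow> \<phi> x = 0"
  shows "(integral_upto \<phi> has_real_derivative \<phi> x) (at x)"
proof -
  have "isCont \<phi> x" for x using cont by (simp add: continuous_on_eq_continuous_at)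
  then obtain G where "\<And>x. (G has_vector_derivative \<phi> x) (at x)"
    using einterval_antiderivative[of "-\<infinity>" "\<infinity>" \<phi>] by auto
  then have G: "(G has_real_derivative \<phi> x) (at x)" for x
    by (simp add: has_real_derivative_iff_has_vector_derivative)
  have "integral_upto \<phi> x = G x - G a" for x
  proof (cases "x \<le> a")
    case True
    have "G x = G a"
    proof (cases "x = a")
      case False
      have "G a = G x"
      proof (rule DERIV_isconst2[of x a])
        show "continuous_on {x..a} G"
          using G by (meson DERIV_continuous_on has_field_derivative_at_within)
        show "(G has_real_derivative 0) (at y)" if "x < y" "y < a" for y
          using G[of y] supp[of y] that by simp
      qed (use True False in auto)
      then show ?thesis by simp
    qed simp
    then show ?thesis using integral_upto_below_support[of a b \<phi> x] supp True by simp
  next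
    case False
    have "(\<lambda>y. indicator {..x} y * \<phi> y) = (\<lambda>y. indicator {a..x} y *\<^sub>R \<phi> y)"
    proof
      show "indicator {..x} y * \<phi> y = indicator {a..x} y *\<^sub>R \<phi> y" for y
        using supp[of y] by (cases "y \<in> {a<..<b}") (auto simp: indicator_def)
    qed
    moreover have "(LINT y|lborel. indicator {a..x} y *\<^sub>R \<phi> y) = G x - G a"
      using False G cont
      by (intro integral_FTC_atLeastAtMost)
        (auto simp: has_real_derivative_iff_has_vector_derivative
          intro: has_vector_derivative_at_within continuous_on_subset)
    ultimately show ?thesis unfolding integral_upto_def by simp
  qed
  then have "integral_upto \<phi> = (\<lambda>x. G x - G a)" by (rule ext)
  then show ?thesis using G by (auto intro!: derivative_eq_intros)
qed

section \<open>Integrable functions with integrable distributional derivative\<close>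

text \<open>The antiderivative \<open>F\<close> of a bump \<open>\<beta>\<close> is constant near \<open>+\<infinity>\<close>, usually not \<open>0\<close>, and so not a test
function. The differences \<open>F x - F (x - t)\<close> are. As \<open>t\<close> tends to \<open>+\<infinity>\<close>, the second term tends
to \<open>0\<close>; as \<open>t\<close> tends to \<open>-\<infinity>\<close>, it tends to the integral of \<open>\<beta>\<close>. Both limits evaluate the same
integral of \<open>u * \<beta>\<close>, and comparing them gives the second claim.\<close>
lemma has_distr_deriv_test_against_antiderivative:
  assumes uint: "integrable lborel u" and dint: "integrable lborel d"
    and ud: "has_distr_deriv u d"
    and sm: "built_smooth \<beta>" and supp: "\<And>x. x \<notin> {a<..<b} \<Longrightarrow> \<beta> x = 0"
  shows "(LINT x|lborel. u x * \<beta> x) = - (LINT x|lborel. integral_upto \<beta> x * d x)"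
    and "(LINT x|lborel. \<beta> x) * (LINT x|lborel. d x) = 0"
proof -
  define F where "F = integral_upto \<beta>"
  define I where "I = (LINT x|lborel. \<beta> x)"
  note cont = built_smooth_continuous[OF sm]
  have DF: "(F has_real_derivative \<beta> x) (at x)" for x
    unfolding F_def by (rule integral_upto_has_derivative[OF cont supp])
  have smF: "built_smooth F" by (rule built_smooth.antiderivative[OF sm DF])
  have F0: "F x = 0" if "x \<le> a" for x
    unfolding F_def using supp that by (rule integral_upto_below_support)
  have FI: "F x = I" if "b \<le> x" for x
    unfolding F_def I_def using supp that by (rule integral_upto_above_support)
  have \<beta>int: "integrable lborel \<beta>"
    using cont supp by (rule integrable_continuous_compact_support)
  obtain C where C: "0 \<le> C" "\<And>x. \<bar>\<beta> x\<bar> \<le> C"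
    using bounded_continuous_compact_support[OF cont supp] by blast
  obtain K where K: "\<And>x. \<bar>F x\<bar> \<le> K"
    using abs_integral_upto_le[OF \<beta>int] unfolding F_def by blast
  have meas [measurable]: "u \<in> borel_measurable borel" "d \<in> borel_measurable borel"
    "\<beta> \<in> borel_measurable borel" "F \<in> borel_measurable borel"
    using uint dint \<beta>int by (auto simp: F_def)
  \<comment> \<open>The identity defining the distributional derivative, for the test function
      \<open>F x - F (x - t)\<close>.\<close>
  have shift: "(LINT x|lborel. u x * (\<beta> x - \<beta> (x - t))) =
      - (LINT x|lborel. d x * (F x - F (x - t)))" for t
  proof -
    define \<psi> where "\<psi> x = F x + (-1) * F (- t + 1 * x)" for x
    have D\<psi>: "(\<psi> has_real_derivative \<beta> x - \<beta> (x - t)) (at x)" for x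
    proof -
      have "((\<lambda>x. F (x - t)) has_real_derivative \<beta> (x - t) * 1) (at x)"
        by (rule DERIV_chain2[OF DF]) (auto intro!: derivative_eq_intros)
      then show ?thesis
        unfolding \<psi>_def[abs_def] using DF[of x] by (auto intro!: derivative_eq_intros)
    qed
    have "test_function \<psi>"
    proof (rule built_smooth_test_function)
      show "built_smooth \<psi>"
        unfolding \<psi>_def[abs_def]
        by (intro built_smooth.add built_smooth.mult built_smooth.const built_smooth.affine smF)
      show "\<psi> x = 0" if "x \<notin> {a - \<bar>t\<bar> .. b + \<bar>t\<bar>}" for x
      proof (cases "x < a - \<bar>t\<bar>")
        case True
        then show ?thesis using F0[of x] F0[of "x - t"] by (simp add: \<psi>_def)
      next
        case False
        then show ?thesis using FI[of x] FI[of "x - t"] that by (simp add: \<psi>_def)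
      qed
    qed
    then have "(LINT x|lborel. u x * deriv \<psi> x) = - (LINT x|lborel. d x * \<psi> x)"
      using ud by (simp add: has_distr_deriv_def)
    moreover have "deriv \<psi> x = \<beta> x - \<beta> (x - t)" for x
      using D\<psi> by (rule DERIV_imp_deriv)
    ultimately show ?thesis by (simp add: \<psi>_def)
  qed
  have limits: "(LINT x|lborel. u x * \<beta> x) = - (LINT x|lborel. d x * (F x - c))"
    if t: "\<And>x. \<forall>\<^sub>F n in sequentially. \<beta> (x - t n) = 0 \<and> F (x - t n) = c"
    for t :: "nat \<Rightarrow> real" and c
  proof (rule LIMSEQ_unique)
    show "(\<lambda>n. LINT x|lborel. u x * (\<beta> x - \<beta> (x - t n))) \<longlonglongrightarrow> (LINT x|lborel. u x * \<beta> x)"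
    proof (rule integral_dominated_convergence[where w = "\<lambda>x. \<bar>u x\<bar> * (2 * C)"])
      show "AE x in lborel. (\<lambda>n. u x * (\<beta> x - \<beta> (x - t n))) \<longlonglongrightarrow> u x * \<beta> x"
      proof (rule AE_I2)
        fix x
        have "\<forall>\<^sub>F n in sequentially. u x * \<beta> x = u x * (\<beta> x - \<beta> (x - t n))"
          using t[of x] by eventually_elim simp
        then show "(\<lambda>n. u x * (\<beta> x - \<beta> (x - t n))) \<longlonglongrightarrow> u x * \<beta> x"
          by (rule Lim_transform_eventually[OF tendsto_const])
      qed
      show "AE x in lborel. norm (u x * (\<beta> x - \<beta> (x - t n))) \<le> \<bar>u x\<bar> * (2 * C)" for n
      proof (rule AE_I2)
        fix x
        have "\<bar>\<beta> x - \<beta> (x - t n)\<bar> \<le> 2 * C" using C(2)[of x] C(2)[of "x - t n"] by linarith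
        then show "norm (u x * (\<beta> x - \<beta> (x - t n))) \<le> \<bar>u x\<bar> * (2 * C)"
          by (simp add: abs_mult mult_left_mono)
      qed
    qed (use uint in auto)
    have "(\<lambda>n. LINT x|lborel. d x * (F x - F (x - t n))) \<longlonglongrightarrow> (LINT x|lborel. d x * (F x - c))"
    proof (rule integral_dominated_convergence[where w = "\<lambda>x. \<bar>d x\<bar> * (2 * K)"])
      show "AE x in lborel. (\<lambda>n. d x * (F x - F (x - t n))) \<longlonglongrightarrow> d x * (F x - c)"
      proof (rule AE_I2)
        fix x
        have "\<forall>\<^sub>F n in sequentially. d x * (F x - c) = d x * (F x - F (x - t n))"
          using t[of x] by eventually_elim simp
        then show "(\<lambda>n. d x * (F x - F (x - t n))) \<longlonglongrightarrow> d x * (F x - c)"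
          by (rule Lim_transform_eventually[OF tendsto_const])
      qed
      show "AE x in lborel. norm (d x * (F x - F (x - t n))) \<le> \<bar>d x\<bar> * (2 * K)" for n
      proof (rule AE_I2)
        fix x
        have "\<bar>F x - F (x - t n)\<bar> \<le> 2 * K" using K[of x] K[of "x - t n"] by linarith
        then show "norm (d x * (F x - F (x - t n))) \<le> \<bar>d x\<bar> * (2 * K)"
          by (simp add: abs_mult mult_left_mono)
      qed
    qed (use dint in auto)
    then show "(\<lambda>n. LINT x|lborel. u x * (\<beta> x - \<beta> (x - t n))) \<longlonglongrightarrow>
        - (LINT x|lborel. d x * (F x - c))"
      unfolding shift by (rule tendsto_minus)
  qed
  have right: "(LINT x|lborel. u x * \<beta> x) = - (LINT x|lborel. d x * (F x - 0))"
  proof (rule limits[where t = "\<lambda>n. real n"])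
    fix x
    obtain N where N: "x - a \<le> real N" using real_arch_simple by blast
    show "\<forall>\<^sub>F n in sequentially. \<beta> (x - real n) = 0 \<and> F (x - real n) = 0"
      using N by (auto simp: eventually_sequentially intro!: exI[of _ N] supp F0)
  qed
  have left: "(LINT x|lborel. u x * \<beta> x) = - (LINT x|lborel. d x * (F x - I))"
  proof (rule limits[where t = "\<lambda>n. - real n"])
    fix x
    obtain N where N: "b - x \<le> real N" using real_arch_simple by blast
    show "\<forall>\<^sub>F n in sequentially. \<beta> (x - (- real n)) = 0 \<and> F (x - (- real n)) = I"
      using N by (auto simp: eventually_sequentially intro!: exI[of _ N] supp FI)
  qed
  show "(LINT x|lborel. u x * \<beta> x) = - (LINT x|lborel. integral_upto \<beta> x * d x)"
    using right by (simp add: F_def mult.commute)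
  have dF: "integrable lborel (\<lambda>x. d x * F x)"
    using integrable_mult_integral_upto[OF \<beta>int dint] by (simp add: F_def mult.commute)
  have "(LINT x|lborel. d x * (F x - I)) = (LINT x|lborel. d x * F x) - (LINT x|lborel. d x) * I"
    using dF dint by (simp add: right_diff_distrib)
  then show "(LINT x|lborel. \<beta> x) * (LINT x|lborel. d x) = 0"
    using left right by (auto simp: I_def)
qed

lemma integral_distr_deriv_zero:
  assumes "integrable lborel u" "integrable lborel d" "has_distr_deriv u d"
  shows "(LINT x|lborel. d x) = 0"
proof -
  let ?\<beta> = "bump 0 1 0"
  have D: "(integral_upto ?\<beta> has_real_derivative ?\<beta> x) (at x)" for x
    by (rule integral_upto_has_derivative[OF built_smooth_continuous[OF built_smooth_bump] bump_outside])
  obtain z where z: "0 < z" "z < 1" "integral_upto ?\<beta> 1 - integral_upto ?\<beta> 0 = (1 - 0) * ?\<beta> z"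
    using MVT2[of 0 1 "integral_upto ?\<beta>" ?\<beta>] D by auto
  moreover have "integral_upto ?\<beta> 0 = 0"
    by (rule integral_upto_below_support[OF bump_outside]) auto
  moreover have "integral_upto ?\<beta> 1 = (LINT x|lborel. ?\<beta> x)"
    by (rule integral_upto_above_support[OF bump_outside]) auto
  moreover have "0 < ?\<beta> z" using z by (intro bump_pos) auto
  ultimately have "(LINT x|lborel. ?\<beta> x) \<noteq> 0" by auto
  moreover have "(LINT x|lborel. ?\<beta> x) * (LINT x|lborel. d x) = 0"
    by (rule has_distr_deriv_test_against_antiderivative(2)[OF assms built_smooth_bump bump_outside])
  ultimately show ?thesis by simp
qed

text \<open>Integration by parts moves the antiderivative from the bump to \<open>d\<close>: the boundary term is a multiple
of the integral of \<open>d\<close>, which is \<open>0\<close>. Hence \<open>u\<close> and the indefinite integral of \<open>d\<close> have the same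
integral against every bump, and thus over every interval.\<close>
lemma distr_deriv_primitive:
  assumes uint: "integrable lborel u" and dint: "integrable lborel d"
    and ud: "has_distr_deriv u d"
  shows "AE x in lborel. u x = integral_upto d x"
proof -
  have [measurable]: "u \<in> borel_measurable borel" "d \<in> borel_measurable borel"
    using uint dint by auto
  define K where "K = (LINT y|lborel. \<bar>d y\<bar>)"
  have K: "\<bar>integral_upto d x\<bar> \<le> K" for x
    unfolding K_def by (rule abs_integral_upto_le[OF dint])
  let ?w = "\<lambda>x. u x - integral_upto d x"
  have bound: "integrable lborel (\<lambda>x. indicator {a<..<b} x * (\<bar>u x\<bar> + K))" for a b :: real
  proof -
    have "integrable lborel (indicator {a<..<b} :: real \<Rightarrow> real)"
      by (rule integrable_real_indicator) (use emeasure_lborel_box_finite[of a b] in auto)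
    then show ?thesis
      using uint by (simp add: distrib_left integrable_indicator_mult)
  qed
  have test: "(LINT x|lborel. bump a b n x * ?w x) = 0" for a b n
  proof -
    let ?\<beta> = "bump a b n"
    note supp = bump_outside[of _ a b n]
    have \<beta>int: "integrable lborel ?\<beta>"
      by (rule integrable_continuous_compact_support[OF built_smooth_continuous[OF built_smooth_bump] supp])
    have [measurable]: "?\<beta> \<in> borel_measurable borel" using \<beta>int by auto
    have "(LINT x|lborel. integral_upto ?\<beta> x * d x) + (LINT x|lborel. integral_upto d x * ?\<beta> x) = 0"
      using integral_by_parts[OF dint \<beta>int] integral_distr_deriv_zero[OF assms] by simp
    then have "(LINT x|lborel. u x * ?\<beta> x) = (LINT x|lborel. integral_upto d x * ?\<beta> x)"
      using has_distr_deriv_test_against_antiderivative(1)[OF assms built_smooth_bump supp] by simp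
    moreover have "integrable lborel (\<lambda>x. u x * ?\<beta> x)"
      using integrable_mult_bounded[OF uint, of ?\<beta> 1] bump_bounds[of a b n]
      by (simp add: mult.commute)
    moreover have "integrable lborel (\<lambda>x. integral_upto d x * ?\<beta> x)"
      by (rule integrable_mult_integral_upto[OF dint \<beta>int])
    ultimately show ?thesis by (simp add: right_diff_distrib mult.commute)
  qed
  have "AE x in lborel. ?w x = 0"
  proof (rule interval_integrals_zero_imp_AE_zero)
    show "integrable lborel (\<lambda>x. indicator {a<..<b} x * ?w x)" for a b
      by (rule Bochner_Integration.integrable_bound[OF bound[of a b]])
        (use K in \<open>auto simp: indicator_def intro!: AE_I2 order.trans[OF abs_triangle_ineq4] order.trans[OF _ abs_ge_self]\<close>)
    fix a b :: real
    have "(\<lambda>n. LINT x|lborel. bump a b n x * ?w x) \<longlonglongrightarrow> (LINT x|lborel. indicator {a<..<b} x * ?w x)"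
    proof (rule integral_dominated_convergence[OF _ _ bound[of a b]])
      show "(\<lambda>x. bump a b n x * ?w x) \<in> borel_measurable lborel" for n
      proof -
        have [measurable]: "bump a b n \<in> borel_measurable borel"
          by (intro borel_measurable_continuous_onI built_smooth_continuous built_smooth_bump)
        show ?thesis by measurable
      qed
      show "AE x in lborel. (\<lambda>n. bump a b n x * ?w x) \<longlonglongrightarrow> indicator {a<..<b} x * ?w x"
        by (intro AE_I2 tendsto_mult tendsto_const bump_tendsto_indicator)
      show "AE x in lborel. norm (bump a b n x * ?w x) \<le> indicator {a<..<b} x * (\<bar>u x\<bar> + K)" for n
      proof (rule AE_I2)
        fix x
        have "\<bar>?w x\<bar> \<le> \<bar>u x\<bar> + K" using K[of x] by linarith
        then have "\<bar>bump a b n x\<bar> * \<bar>?w x\<bar> \<le> 1 * (\<bar>u x\<bar> + K)"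
          using bump_bounds[of a b n x] by (intro mult_mono) auto
        then show "norm (bump a b n x * ?w x) \<le> indicator {a<..<b} x * (\<bar>u x\<bar> + K)"
          using bump_outside[of x a b n] by (cases "x \<in> {a<..<b}") (auto simp: abs_mult)
      qed
    qed auto
    then show "(LINT x|lborel. indicator {a<..<b} x * ?w x) = 0"
      by (simp add: test LIMSEQ_const_iff)
  qed
  then show ?thesis by eventually_elim simp
qed

lemma locally_integrable_measurable:
  assumes "locally_integrable u"
  shows "u \<in> borel_measurable borel"
proof (rule borel_measurable_LIMSEQ_real)
  show "(\<lambda>x. indicator {- real n..real n} x * u x) \<in> borel_measurable borel" for n
  proof -
    have "set_integrable lborel {- real n..real n} u"
      using assms by (simp add: locally_integrable_def)
    then show ?thesis
      using borel_measurable_integrable by (fastforce simp: set_integrable_def)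
  qed
  fix x :: real
  obtain N where "\<bar>x\<bar> \<le> real N" using real_arch_simple by blast
  then have "\<forall>\<^sub>F n in sequentially. u x = indicator {- real n..real n} x * u x"
    by (auto simp: eventually_sequentially indicator_def intro!: exI[of _ N])
  then show "(\<lambda>n. indicator {- real n..real n} x * u x) \<longlonglongrightarrow> u x"
    by (rule Lim_transform_eventually[OF tendsto_const])
qed

lemma has_distr_deriv_distr_deriv: "has_distr_deriv u d \<Longrightarrow> has_distr_deriv u (distr_deriv u)"
  unfolding distr_deriv_def using someI[of "has_distr_deriv u" d] by auto

lemma higher_deriv_shift:
  assumes "\<And>n x. ((deriv ^^ n) \<psi>) differentiable (at (x :: real))"
  shows "(deriv ^^ n) (\<lambda>x. \<psi> (x + m)) = (\<lambda>x. (deriv ^^ n) \<psi> (x + m :: real) :: real)"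
proof (induction n)
  case (Suc n)
  have "deriv (\<lambda>x. (deriv ^^ n) \<psi> (x + m)) x = deriv ((deriv ^^ n) \<psi>) (x + m)" for x
    using assms[of n "x + m"]
    by (intro DERIV_imp_deriv)
      (simp add: DERIV_deriv_iff_real_differentiable[symmetric] DERIV_shift)
  then show ?case using Suc by auto
qed simp

lemma test_function_shift:
  assumes "test_function \<psi>"
  shows "test_function (\<lambda>x. \<psi> (x + m))"
proof -
  have d: "((deriv ^^ n) \<psi>) differentiable (at x)" for n x
    using assms by (simp add: test_function_def)
  have "((deriv ^^ n) (\<lambda>x. \<psi> (x + m))) differentiable (at x)" for n x
    unfolding higher_deriv_shift[OF d]
    using d[of n "x + m"] unfolding real_differentiable_def by (simp add: DERIV_shift)
  moreover have "compact (closure {x. \<psi> (x + m) \<noteq> 0})"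
  proof -
    have "{x. \<psi> (x + m) \<noteq> 0} = (\<lambda>x. - m + x) ` {x. \<psi> x \<noteq> 0}"
      by (auto simp: image_iff intro!: exI[of _ "_ + m"])
    moreover have "compact (closure {x. \<psi> x \<noteq> 0})"
      using assms by (simp add: test_function_def)
    ultimately show ?thesis
      by (simp only: closure_translation compact_translation)
  qed
  ultimately show ?thesis by (simp add: test_function_def)
qed

lemma locally_integrable_shift:
  assumes "locally_integrable u"
  shows "locally_integrable (\<lambda>x. u (x - m))"
  unfolding locally_integrable_def set_integrable_def
proof (intro allI)
  fix a b
  have "integrable lborel (\<lambda>x. indicator {a - m..b - m} x *\<^sub>R u x)"
    using assms by (auto simp: locally_integrable_def set_integrable_def)
  then have "integrable lborel (\<lambda>x. indicator {a - m..b - m} (- m + 1 * x) *\<^sub>R u (- m + 1 * x))"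
    by (rule lborel_integrable_real_affine) simp
  moreover have "(\<lambda>x. indicator {a - m..b - m} (- m + 1 * x) *\<^sub>R u (- m + 1 * x)) =
      (\<lambda>x. indicator {a..b} x *\<^sub>R u (x - m))"
    by (auto simp: indicator_def)
  ultimately show "integrable lborel (\<lambda>x. indicator {a..b} x *\<^sub>R u (x - m))" by simp
qed

lemma has_distr_deriv_shift:
  assumes ud: "has_distr_deriv u d"
  shows "has_distr_deriv (\<lambda>x. u (x - m)) (\<lambda>x. d (x - m))"
  unfolding has_distr_deriv_def
proof (intro conjI allI impI)
  show "locally_integrable (\<lambda>x. u (x - m))" "locally_integrable (\<lambda>x. d (x - m))"
    using ud by (auto simp: has_distr_deriv_def intro: locally_integrable_shift)
  fix \<psi> assume \<psi>: "test_function \<psi>"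
  have d: "((deriv ^^ n) \<psi>) differentiable (at x)" for n x
    using \<psi> by (simp add: test_function_def)
  have "(LINT x|lborel. u (x - m) * deriv \<psi> x) = (LINT x|lborel. u x * deriv \<psi> (x + m))"
    by (subst lborel_integral_real_affine[where c = 1 and t = m]) (auto simp: add.commute)
  also have "\<dots> = (LINT x|lborel. u x * deriv (\<lambda>x. \<psi> (x + m)) x)"
    using higher_deriv_shift[OF d, of 1 m] by simp
  also have "\<dots> = - (LINT x|lborel. d x * \<psi> (x + m))"
    using ud test_function_shift[OF \<psi>] by (simp add: has_distr_deriv_def)
  also have "(LINT x|lborel. d x * \<psi> (x + m)) = (LINT x|lborel. d (x - m) * \<psi> x)"
    by (subst (2) lborel_integral_real_affine[where c = 1 and t = m]) (auto simp: add.commute)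
  finally show "(LINT x|lborel. u (x - m) * deriv \<psi> x) = - (LINT x|lborel. d (x - m) * \<psi> x)" .
qed

text \<open>This makes the convention \<open>1 / g0 = 0\<close> off the support harmless: \<open>f0 * g0\<close> vanishes there, hence
almost everywhere there so does its distributional derivative.\<close>
lemma distr_deriv_zero_on_zeros:
  assumes "integrable lborel u" "integrable lborel d" "has_distr_deriv u d"
  shows "AE x in lborel. u x = 0 \<longrightarrow> d x = 0"
  using distr_deriv_primitive[OF assms] integrand_zero_on_zeros[OF assms(2)] by eventually_elim simp

section \<open>Expectation of the Stein operator under the model\<close>

lemma G_loc_measurable:
  assumes "g0 \<in> G_loc \<mu>0"
  shows "g0 \<in> borel_measurable borel"
proof -
  have "loc_model g0 \<in> G_dens \<mu>0" using assms by (simp add: G_loc_def)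
  then have [measurable]: "(\<lambda>(x, \<mu>). g0 (x - \<mu>)) \<in> borel_measurable (borel \<Otimes>\<^sub>M borel)"
    unfolding G_dens_def loc_model_def mem_Collect_eq by (elim conjE)
  have "(\<lambda>x. (\<lambda>(x, \<mu>). g0 (x - \<mu>)) (x, 0)) \<in> borel_measurable borel"
    by measurable
  then show ?thesis by simp
qed

text \<open>Multiplying the operator by the model density cancels the denominator on the support. Off the
support, both the product and, almost everywhere, the derivative are \<open>0\<close>. What remains is minus the
integral of the distributional derivative of an integrable function over the whole line.\<close>
lemma T_loc_expectation_zero:
  assumes g0: "g0 \<in> G_loc \<mu>0" and f0: "f0 \<in> F_loc g0 \<mu>0"
  shows "T_loc \<mu>0 f0 g0 \<in> borel_measurable borel"
    and "has_bochner_integral (density lborel (\<lambda>x. ennreal (g0 (x - \<mu>0)))) (T_loc \<mu>0 f0 g0) 0"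
proof -
  define u where "u = (\<lambda>y. f0 (y - \<mu>0) * g0 (y - \<mu>0))"
  define d where "d = distr_deriv u"
  have [measurable]: "g0 \<in> borel_measurable borel" by (rule G_loc_measurable[OF g0])
  have g0_nonneg: "0 \<le> g0 x" for x using g0 by (auto simp: G_loc_def)
  have uint: "integrable lborel u"
    using f0 by (auto simp: F_loc_def u_def has_bochner_integral_iff)
  have ud: "has_distr_deriv u d"
  proof -
    obtain d' where "has_distr_deriv (\<lambda>x. f0 x * g0 x) d'"
      using f0 by (auto simp: F_loc_def)
    from has_distr_deriv_distr_deriv[OF has_distr_deriv_shift[OF this, of \<mu>0]]
    show ?thesis by (simp add: u_def d_def)
  qed
  then have [measurable]: "d \<in> borel_measurable borel"
    by (auto simp: has_distr_deriv_def intro: locally_integrable_measurable)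
  have T: "T_loc \<mu>0 f0 g0 x = - d x / g0 (x - \<mu>0)" for x
    by (simp add: T_loc_def u_def d_def)
  show meas: "T_loc \<mu>0 f0 g0 \<in> borel_measurable borel"
    unfolding T[abs_def] by measurable
  have dint: "integrable lborel d"
  proof -
    obtain \<Theta>0 h where "bounded_nbhd \<mu>0 \<Theta>0" and h: "integrable lborel h"
      and bd: "\<forall>\<mu>\<in>\<Theta>0. AE x in lborel. \<bar>distr_deriv (\<lambda>y. f0 (y - \<mu>) * g0 (y - \<mu>)) x\<bar> \<le> h x"
      using f0 by (auto simp: F_loc_def)
    then have "\<mu>0 \<in> \<Theta>0" using interior_subset by (auto simp: bounded_nbhd_def)
    then have "AE x in lborel. \<bar>d x\<bar> \<le> h x" using bd by (auto simp: d_def u_def)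
    then have "AE x in lborel. norm (d x) \<le> norm (h x)" by eventually_elim auto
    then show ?thesis using h by (intro Bochner_Integration.integrable_bound[OF h]) auto
  qed
  have "AE x in lborel. u x = 0 \<longrightarrow> d x = 0"
    by (rule distr_deriv_zero_on_zeros[OF uint dint ud])
  then have "AE x in lborel. g0 (x - \<mu>0) *\<^sub>R T_loc \<mu>0 f0 g0 x = - d x"
    by eventually_elim (auto simp: T u_def)
  moreover have "has_bochner_integral lborel (\<lambda>x. - d x) 0"
    using dint integral_distr_deriv_zero[OF uint dint ud] by (simp add: has_bochner_integral_iff)
  ultimately have "has_bochner_integral lborel (\<lambda>x. g0 (x - \<mu>0) *\<^sub>R T_loc \<mu>0 f0 g0 x) 0"
    using meas by (subst has_bochner_integral_cong_AE[where g = "\<lambda>x. - d x"]) auto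
  then show "has_bochner_integral (density lborel (\<lambda>x. ennreal (g0 (x - \<mu>0)))) (T_loc \<mu>0 f0 g0) 0"
    using meas g0_nonneg by (intro has_bochner_integral_density) auto
qed

section \<open>Measures annihilating derivatives\<close>

definition trapezoid :: "real \<Rightarrow> real \<Rightarrow> nat \<Rightarrow> real \<Rightarrow> real" where
  "trapezoid a b n x = max 0 (min 1 (real (Suc n) * min (x - a) (b - x)))"

lemma trapezoid_continuous: "continuous_on UNIV (trapezoid a b n)"
  unfolding trapezoid_def[abs_def] by (intro continuous_intros)

lemma trapezoid_outside:
  assumes "x \<notin> {a<..<b}"
  shows "trapezoid a b n x = 0"
proof -
  have "min (x - a) (b - x) \<le> 0" using assms by auto
  then have "real (Suc n) * min (x - a) (b - x) \<le> 0" by (intro mult_nonneg_nonpos) auto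
  then show ?thesis unfolding trapezoid_def by linarith
qed

lemma trapezoid_le_indicator: "0 \<le> trapezoid a b n x" "trapezoid a b n x \<le> indicator {a<..<b} x"
  using trapezoid_outside[of x a b n] by (auto simp: trapezoid_def indicator_def)

lemma indicator_le_trapezoid: "indicator {a<..<b} x \<le> trapezoid (a - 1) (b + 1) 0 x"
  by (auto simp: trapezoid_def indicator_def)

lemma trapezoid_tendsto_indicator: "(\<lambda>n. trapezoid a b n x) \<longlonglongrightarrow> indicator {a<..<b} x"
proof (cases "x \<in> {a<..<b}")
  case True
  define e where "e = min (x - a) (b - x)"
  have e: "0 < e" using True by (simp add: e_def)
  obtain N where N: "1 / e \<le> real N" using real_arch_simple by blast
  have "trapezoid a b n x = 1" if "N \<le> n" for n
  proof -
    have "1 / e \<le> real (Suc n)" using N that by linarith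
    then have "1 \<le> real (Suc n) * e" using e by (simp add: field_simps)
    then show ?thesis by (simp add: trapezoid_def e_def[symmetric])
  qed
  then have "\<forall>\<^sub>F n in sequentially. 1 = trapezoid a b n x"
    by (auto simp: eventually_sequentially intro!: exI[of _ N])
  then have "(\<lambda>n. trapezoid a b n x) \<longlonglongrightarrow> 1"
    by (rule Lim_transform_eventually[OF tendsto_const])
  then show ?thesis using True by simp
qed (simp add: trapezoid_outside)

lemma integral_trapezoid_tendsto_measure:
  assumes sets: "sets N = sets borel" and "integrable N (trapezoid (a - 1) (b + 1) 0)"
  shows "(\<lambda>n. LINT x|N. trapezoid a b n x) \<longlonglongrightarrow> measure N {a<..<b}"
    and "emeasure N {a<..<b} < \<infinity>"
proof -
  have [measurable_cong]: "sets N = sets borel" by fact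
  have [measurable]: "trapezoid a b n \<in> borel_measurable borel" for n
    by (intro borel_measurable_continuous_onI trapezoid_continuous)
  have "integrable N (indicator {a<..<b} :: real \<Rightarrow> real)"
    by (rule Bochner_Integration.integrable_bound[OF assms(2)])
      (use indicator_le_trapezoid trapezoid_le_indicator in \<open>auto simp: abs_of_nonneg\<close>)
  then show "emeasure N {a<..<b} < \<infinity>"
    using sets by (simp add: integrable_indicator_iff)
  have "(\<lambda>n. LINT x|N. trapezoid a b n x) \<longlonglongrightarrow> (LINT x|N. indicator {a<..<b} x)"
  proof (rule integral_dominated_convergence[OF _ _ assms(2)])
    show "AE x in N. norm (trapezoid a b n x) \<le> trapezoid (a - 1) (b + 1) 0 x" for n
      using order.trans[OF trapezoid_le_indicator(2) indicator_le_trapezoid]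
      by (auto simp: abs_of_nonneg trapezoid_le_indicator)
  qed (auto simp: trapezoid_tendsto_indicator)
  then show "(\<lambda>n. LINT x|N. trapezoid a b n x) \<longlonglongrightarrow> measure N {a<..<b}"
    using sets by simp
qed

text \<open>Continuous functions with compact support and integral \<open>0\<close> are the derivatives of compactly
supported continuously differentiable functions, so the hypothesis says that \<open>N\<close> has derivative
\<open>0\<close>. Any two functions \<open>\<phi>\<close>, \<open>\<psi>\<close> combine to \<open>(\<integral>\<psi>) \<phi> - (\<integral>\<phi>) \<psi>\<close>, which has integral \<open>0\<close>; hence their
integrals with respect to \<open>N\<close> are in the same proportion as their Lebesgue integrals. Applied to
trapezoids increasing to \<open>(a, b)\<close> and \<open>(0, 1)\<close>, this determines \<open>N\<close> on all open intervals.\<close>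
lemma annihilates_derivatives_imp_multiple_of_lborel:
  fixes N :: "real measure"
  assumes sets: "sets N = sets borel"
    and zero: "\<And>\<phi> a b. continuous_on UNIV \<phi> \<Longrightarrow> (\<And>x. x \<notin> {a<..<b} \<Longrightarrow> \<phi> x = 0) \<Longrightarrow>
                 (LINT x|lborel. \<phi> x) = 0 \<Longrightarrow> has_bochner_integral N \<phi> (0 :: real)"
  shows "\<exists>c. N = density lborel (\<lambda>_. ennreal c)"
proof -
  \<comment> \<open>Local finiteness of \<open>N\<close>: \<open>\<phi>\<close> minus a disjoint translate of itself has integral \<open>0\<close> and is
      therefore integrable, and \<open>\<phi>\<close> is its restriction to an interval.\<close>
  have int: "integrable N \<phi>"
    if cont: "continuous_on UNIV \<phi>" and supp: "\<And>x. x \<notin> {a<..<b} \<Longrightarrow> \<phi> x = 0"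
    for \<phi> :: "real \<Rightarrow> real" and a b
  proof -
    define t where "t = \<bar>b - a\<bar>"
    have "has_bochner_integral N (\<lambda>x. \<phi> x - \<phi> (x - t)) 0"
    proof (rule zero)
      show "continuous_on UNIV (\<lambda>x. \<phi> x - \<phi> (x - t))"
        by (rule continuous_on_diff[OF cont continuous_on_compose2[OF cont]])
          (auto intro: continuous_intros)
      show "\<phi> x - \<phi> (x - t) = 0" if "x \<notin> {a<..<b + t}" for x
        using that supp[of x] supp[of "x - t"] by (auto simp: t_def abs_if split: if_splits)
      have \<phi>: "integrable lborel \<phi>"
        using cont supp by (rule integrable_continuous_compact_support)
      have "integrable lborel (\<lambda>x. \<phi> (- t + 1 * x))"
        using \<phi> by (rule lborel_integrable_real_affine) simp
      moreover have "(LINT x|lborel. \<phi> x) = (LINT x|lborel. \<phi> (- t + 1 * x))"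
        by (subst lborel_integral_real_affine[where c = 1 and t = "- t"]) auto
      ultimately show "(LINT x|lborel. \<phi> x - \<phi> (x - t)) = 0" using \<phi> by simp
    qed
    then have "integrable N (\<lambda>x. (\<phi> x - \<phi> (x - t)) * indicator {a<..<b} x)"
      using sets by (intro integrable_real_mult_indicator) (auto simp: has_bochner_integral_iff)
    moreover have "(\<phi> x - \<phi> (x - t)) * indicator {a<..<b} x = \<phi> x" for x
      using supp[of x] supp[of "x - t"] by (cases "x \<in> {a<..<b}") (auto simp: t_def)
    ultimately show ?thesis by simp
  qed
  have trap_int: "integrable N (trapezoid a b n)" "integrable lborel (trapezoid a b n)" for a b n
    using int[OF trapezoid_continuous trapezoid_outside]
      integrable_continuous_compact_support[OF trapezoid_continuous trapezoid_outside] by auto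
  have proportional: "(LINT x|N. trapezoid a b n x) * (LINT x|lborel. trapezoid 0 1 n x) =
      (LINT x|lborel. trapezoid a b n x) * (LINT x|N. trapezoid 0 1 n x)" for a b n
  proof -
    let ?I = "LINT x|lborel. trapezoid 0 1 n x" and ?J = "LINT x|lborel. trapezoid a b n x"
    have "has_bochner_integral N (\<lambda>x. trapezoid a b n x * ?I - trapezoid 0 1 n x * ?J) 0"
    proof (rule zero)
      show "continuous_on UNIV (\<lambda>x. trapezoid a b n x * ?I - trapezoid 0 1 n x * ?J)"
        by (intro continuous_on_diff continuous_on_mult trapezoid_continuous continuous_on_const)
      show "trapezoid a b n x * ?I - trapezoid 0 1 n x * ?J = 0"
        if "x \<notin> {min a 0<..<max b 1}" for x
        using that trapezoid_outside[of x a b n] trapezoid_outside[of x 0 1 n]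
        by (auto simp: min_def max_def split: if_splits)
    qed (simp add: trap_int)
    then show ?thesis
      using trap_int by (simp add: has_bochner_integral_iff mult.commute)
  qed
  define c where "c = measure N {0<..<1}"
  have lims: "(\<lambda>n. LINT x|N. trapezoid a b n x) \<longlonglongrightarrow> measure N {a<..<b}"
    "(\<lambda>n. LINT x|lborel. trapezoid a b n x) \<longlonglongrightarrow> measure lborel {a<..<b}" for a b
    by (intro integral_trapezoid_tendsto_measure(1) trap_int sets sets_lborel)+
  have Nab: "measure N {a<..<b} = measure lborel {a<..<b} * c" for a b
  proof -
    have "measure N {a<..<b} * measure lborel {0<..<1::real} = measure lborel {a<..<b} * c"
      unfolding c_def
      using tendsto_mult[OF lims(1) lims(2)[of 0 1]] tendsto_mult[OF lims(2) lims(1)[of 0 1]]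
      unfolding proportional by (rule LIMSEQ_unique)
    then show ?thesis by simp
  qed
  have fin: "emeasure N {a<..<b} < \<infinity>" for a b
    by (rule integral_trapezoid_tendsto_measure(2)[OF sets trap_int(1)])
  have finl: "emeasure lborel {a<..<b} < \<infinity>" for a b :: real
    by (rule integral_trapezoid_tendsto_measure(2)[OF sets_lborel trap_int(2)])
  have c: "0 \<le> c" by (simp add: c_def)
  have "N = density lborel (\<lambda>_. ennreal c)"
  proof (rule measure_eqI_generator_eq[where \<Omega> = UNIV])
    let ?E = "range (\<lambda>(a, b). {a<..<b :: real})"
    show "Int_stable ?E"
      by (auto simp: Int_stable_def)
    show "emeasure N A = emeasure (density lborel (\<lambda>_. ennreal c)) A" if E: "A \<in> ?E" for A
    proof -
      obtain a b where A: "A = {a<..<b}" using E by auto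
      have "emeasure N A = ennreal (measure N A)"
        using fin[of a b] by (simp add: A emeasure_eq_ennreal_measure)
      also have "\<dots> = ennreal c * emeasure lborel A"
        using finl[of a b] c by (simp add: A Nab emeasure_eq_ennreal_measure ennreal_mult mult.commute)
      also have "\<dots> = emeasure (density lborel (\<lambda>_. ennreal c)) A"
        by (simp add: A emeasure_density_const)
      finally show ?thesis .
    qed
    have "sets borel = sigma_sets UNIV ?E"
    proof -
      have "range (\<lambda>(a, b). box a b :: real set) = ?E" by (simp add: box_real)
      then have "sets borel = sets (sigma UNIV ?E)" using borel_eq_box[where 'a = real] by simp
      then show ?thesis by (rule trans) (rule sets_measure_of, simp)
    qed
    then show "sets N = sigma_sets UNIV ?E" "sets (density lborel (\<lambda>_. ennreal c)) = sigma_sets UNIV ?E"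
      using sets by simp_all
    show "range (\<lambda>n. {- real n<..<real n}) \<subseteq> ?E" by auto
    show "(\<Union>n. {- real n<..<real n}) = UNIV"
    proof -
      have "\<exists>n. x \<in> {- real n<..<real n}" for x
        using reals_Archimedean2[of "\<bar>x\<bar>"] by (auto simp: abs_less_iff minus_less_iff)
      then show ?thesis by blast
    qed
    show "emeasure N {- real n<..<real n} \<noteq> \<infinity>" for n
      using fin[of "- real n" "real n"] by auto
  qed auto
  then show ?thesis by blast
qed

section \<open>Characterization\<close>

text \<open>For an antiderivative with compact support, the product with a test function vanishes at both ends
of the interval, so integration by parts leaves no boundary term. Its compact support is due to the
vanishing total integral.\<close>
lemma has_distr_deriv_integral_upto:
  assumes cont: "continuous_on UNIV \<phi>" and supp: "\<And>x. x \<notin> {a<..<b} \<Longrightarrow> \<phi> x = 0"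
    and zero: "(LINT x|lborel. \<phi> x) = 0"
  shows "has_distr_deriv (integral_upto \<phi>) \<phi>"
proof -
  define F where "F = integral_upto \<phi>"
  have DF: "(F has_real_derivative \<phi> x) (at x)" for x
    unfolding F_def by (rule integral_upto_has_derivative[OF cont supp])
  then have contF: "continuous_on UNIV F"
    by (meson DERIV_continuous_on has_field_derivative_at_within)
  have F0: "F x = 0" if "x \<notin> {a<..<b}" for x
    using that zero integral_upto_below_support[of a b \<phi> x] integral_upto_above_support[of a b \<phi> x]
      supp by (auto simp: F_def not_less)
  have loc: "locally_integrable w" if "continuous_on UNIV w" for w
    using that unfolding locally_integrable_def
    by (auto intro!: borel_integrable_atLeastAtMost' intro: continuous_on_subset)
  have "(LINT x|lborel. F x * deriv \<psi> x) = - (LINT x|lborel. \<phi> x * \<psi> x)"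
    if "test_function \<psi>" for \<psi>
  proof -
    have d: "((deriv ^^ n) \<psi>) differentiable (at x)" for n x
      using that by (simp add: test_function_def)
    have D\<psi>: "(\<psi> has_real_derivative deriv \<psi> x) (at x)" for x
      using d[of 0 x] by (simp add: DERIV_deriv_iff_real_differentiable)
    have cont\<psi>: "continuous_on UNIV \<psi>" "continuous_on UNIV (deriv \<psi>)"
      using d[of 0] d[of 1] by (auto intro!: continuous_at_imp_continuous_on differentiable_imp_continuous_within)
    let ?F' = "\<lambda>x. F x * deriv \<psi> x" and ?\<phi>\<psi> = "\<lambda>x. \<phi> x * \<psi> x"
    have contF': "continuous_on UNIV ?F'" "continuous_on UNIV ?\<phi>\<psi>"
      by (intro continuous_on_mult contF cont cont\<psi>)+
    have i: "integrable lborel ?F'" "integrable lborel ?\<phi>\<psi>"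
      by (rule integrable_continuous_compact_support[where a = a and b = b],
          rule contF', use F0 supp in simp)+
    have "(LINT x|lborel. ?F' x + ?\<phi>\<psi> x) =
          (LINT x|lborel. indicator {a..max a b} x *\<^sub>R (?F' x + ?\<phi>\<psi> x))"
    proof (rule Bochner_Integration.integral_cong[OF refl])
      show "?F' x + ?\<phi>\<psi> x = indicator {a..max a b} x *\<^sub>R (?F' x + ?\<phi>\<psi> x)" for x
        using F0[of x] supp[of x] by (cases "x \<in> {a<..<b}") auto
    qed
    also have "\<dots> = F (max a b) * \<psi> (max a b) - F a * \<psi> a"
    proof (rule integral_FTC_atLeastAtMost)
      show "((\<lambda>x. F x * \<psi> x) has_vector_derivative ?F' x + ?\<phi>\<psi> x) (at x within {a..max a b})" for x
        unfolding has_real_derivative_iff_has_vector_derivative[symmetric]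
        by (rule has_field_derivative_at_within, rule DERIV_cong[OF DERIV_mult[OF DF D\<psi>]])
          (simp add: algebra_simps)
      show "continuous_on {a..max a b} (\<lambda>x. ?F' x + ?\<phi>\<psi> x)"
        by (rule continuous_on_subset[OF continuous_on_add[OF contF']]) auto
    qed auto
    also have "\<dots> = 0" using F0[of a] F0[of "max a b"] by simp
    finally show ?thesis using i by simp
  qed
  then show ?thesis
    using loc cont contF by (simp add: has_distr_deriv_def F_def)
qed

text \<open>For a positive density, dividing an antiderivative \<open>F\<close> of \<open>\<phi>\<close> by \<open>g0\<close> makes \<open>f0 * g0 = F\<close> regular
however irregular \<open>g0\<close> is. As \<open>F\<close> is differentiable everywhere, the selected version of its
distributional derivative is exactly \<open>\<phi>\<close>, and the operator is known at every point. This matters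
because the law of \<open>X\<close> may charge Lebesgue null sets.\<close>
lemma antiderivative_quotient_in_F_loc:
  assumes pos: "\<And>x. 0 < g0 x"
    and cont: "continuous_on UNIV \<phi>" and supp: "\<And>x. x \<notin> {a<..<b} \<Longrightarrow> \<phi> x = 0"
    and zero: "(LINT x|lborel. \<phi> x) = 0"
  shows "(\<lambda>x. integral_upto \<phi> x / g0 x) \<in> F_loc g0 \<mu>0"
    and "T_loc \<mu>0 (\<lambda>x. integral_upto \<phi> x / g0 x) g0 x = - (\<phi> (x - \<mu>0) / g0 (x - \<mu>0))"
proof -
  define F where "F = integral_upto \<phi>"
  have DF: "(F has_real_derivative \<phi> x) (at x)" for x
    unfolding F_def by (rule integral_upto_has_derivative[OF cont supp])
  then have contF: "continuous_on UNIV F"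
    by (meson DERIV_continuous_on has_field_derivative_at_within)
  have F0: "F x = 0" if "x \<notin> {a<..<b}" for x
    using that zero integral_upto_below_support[of a b \<phi> x] integral_upto_above_support[of a b \<phi> x]
      supp by (auto simp: F_def not_less)
  have Fd: "has_distr_deriv F \<phi>"
    unfolding F_def using cont supp zero by (rule has_distr_deriv_integral_upto)
  have cancel: "F x / g0 x * g0 x = F x" for x
    using pos[of x] by simp
  have dd: "distr_deriv (\<lambda>y. F (y - \<mu>)) = (\<lambda>y. \<phi> (y - \<mu>))" for \<mu>
  proof -
    have D: "((\<lambda>y. F (y - \<mu>)) has_real_derivative \<phi> (y - \<mu>)) (at y)" for y
    proof -
      have "((\<lambda>y. F (y - \<mu>)) has_real_derivative \<phi> (y - \<mu>) * 1) (at y)"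
        by (rule DERIV_chain2[OF DF]) (auto intro!: derivative_eq_intros)
      then show ?thesis by simp
    qed
    then have "deriv (\<lambda>y. F (y - \<mu>)) = (\<lambda>y. \<phi> (y - \<mu>))"
      by (intro ext DERIV_imp_deriv)
    then show ?thesis
      using D has_distr_deriv_shift[OF Fd, of \<mu>] unfolding distr_deriv_def
      by (auto simp: real_differentiable_def)
  qed
  show "T_loc \<mu>0 (\<lambda>x. integral_upto \<phi> x / g0 x) g0 x = - (\<phi> (x - \<mu>0) / g0 (x - \<mu>0))"
    unfolding T_loc_def F_def[symmetric] cancel dd by simp
  have Fint: "integrable lborel F"
    using contF F0 by (rule integrable_continuous_compact_support)
  have same_integral: "has_bochner_integral lborel (\<lambda>x. F (x - \<mu>)) (LINT x|lborel. F x)" for \<mu>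
    using lborel_has_bochner_integral_real_affine_iff[of 1 F "LINT x|lborel. F x" "- \<mu>"] Fint
    by (simp add: has_bochner_integral_integrable)
  obtain C where C: "0 \<le> C" "\<And>x. \<bar>\<phi> x\<bar> \<le> C"
    using bounded_continuous_compact_support[OF cont supp] by blast
  \<comment> \<open>The translates by parameters within distance \<open>1\<close> of \<open>\<mu>0\<close> all live on this interval.\<close>
  let ?h = "\<lambda>x. C * indicator {a + \<mu>0 - 1..b + \<mu>0 + 1} x"
  have bound: "\<bar>\<phi> (x - \<mu>)\<bar> \<le> ?h x" if "\<mu> \<in> {\<mu>0 - 1..\<mu>0 + 1}" for x \<mu>
    using C(2)[of "x - \<mu>"] C(1) supp[of "x - \<mu>"] that by (auto simp: indicator_def)
  have nbhd: "bounded_nbhd \<mu>0 {\<mu>0 - 1..\<mu>0 + 1}"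
    by (simp add: bounded_nbhd_def)
  have h: "integrable lborel ?h"
    by (intro integrable_mult_right integrable_real_indicator)
      (use emeasure_lborel_cbox_finite[of "a + \<mu>0 - 1" "b + \<mu>0 + 1"] in auto)
  show "(\<lambda>x. integral_upto \<phi> x / g0 x) \<in> F_loc g0 \<mu>0"
    unfolding F_loc_def mem_Collect_eq F_def[symmetric] cancel dd
  proof (intro conjI)
    show "\<exists>c. \<forall>\<mu>. has_bochner_integral lborel (\<lambda>x. F (x - \<mu>)) c"
      using same_integral by blast
    show "\<exists>d. has_distr_deriv F d"
      using Fd by blast
    show "\<exists>\<Theta>0 h. bounded_nbhd \<mu>0 \<Theta>0 \<and> integrable lborel h \<and>
        (\<forall>\<mu>\<in>\<Theta>0. AE x in lborel. \<bar>\<phi> (x - \<mu>)\<bar> \<le> h x)"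
      using bound by (intro exI[of _ "{\<mu>0 - 1..\<mu>0 + 1}"] exI[of _ ?h] conjI nbhd h) auto
  qed
qed

text \<open>The Stein identities say that the measure with density \<open>1 / g\<close> with respect to \<open>P\<close> annihilates
derivatives. It is therefore a multiple of Lebesgue measure, and multiplying by \<open>g\<close> shows that \<open>P\<close>
has density \<open>c * g\<close>. Both \<open>P\<close> and \<open>g\<close> have total mass \<open>1\<close>, so \<open>c = 1\<close>.\<close>
lemma density_from_stein_identities:
  fixes P :: "real measure" and g0 :: "real \<Rightarrow> real"
  assumes P: "prob_space P" and sets: "sets P = sets borel"
    and g0: "g0 \<in> G_loc \<mu>0" and pos: "\<And>x. 0 < g0 x"
    and stein: "\<And>f0. f0 \<in> F_loc g0 \<mu>0 \<Longrightarrow> has_bochner_integral P (T_loc \<mu>0 f0 g0) 0"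
  shows "P = density lborel (\<lambda>x. ennreal (g0 (x - \<mu>0)))"
proof -
  define g where "g x = g0 (x - \<mu>0)" for x
  have [measurable]: "g0 \<in> borel_measurable borel" by (rule G_loc_measurable[OF g0])
  have [measurable]: "g \<in> borel_measurable borel" unfolding g_def[abs_def] by measurable
  have [measurable_cong]: "sets P = sets borel" by fact
  have gpos: "0 < g x" for x using pos by (simp add: g_def)
  define N where "N = density P (\<lambda>x. ennreal (inverse (g x)))"
  have "\<exists>c. N = density lborel (\<lambda>_. ennreal c)"
  proof (rule annihilates_derivatives_imp_multiple_of_lborel)
    show "sets N = sets borel" by (simp add: N_def sets)
    fix \<phi> :: "real \<Rightarrow> real" and a b
    assume cont: "continuous_on UNIV \<phi>" and supp: "\<And>x. x \<notin> {a<..<b} \<Longrightarrow> \<phi> x = 0"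
      and zero: "(LINT x|lborel. \<phi> x) = 0"
    have [measurable]: "\<phi> \<in> borel_measurable borel"
      by (rule borel_measurable_continuous_onI[OF cont])
    define \<phi>' where "\<phi>' x = \<phi> (x + \<mu>0)" for x
    have cont': "continuous_on UNIV \<phi>'"
      unfolding \<phi>'_def by (rule continuous_on_compose2[OF cont]) (auto intro: continuous_intros)
    have supp': "\<phi>' x = 0" if "x \<notin> {a - \<mu>0<..<b - \<mu>0}" for x
      using that supp[of "x + \<mu>0"] by (auto simp: \<phi>'_def)
    have zero': "(LINT x|lborel. \<phi>' x) = 0"
      using zero lborel_integral_real_affine[of 1 \<phi> \<mu>0] by (simp add: \<phi>'_def add.commute)
    have "has_bochner_integral P (\<lambda>x. - (\<phi>' (x - \<mu>0) / g0 (x - \<mu>0))) 0"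
    proof -
      let ?f0 = "\<lambda>x. integral_upto \<phi>' x / g0 x"
      note pair = antiderivative_quotient_in_F_loc[where ?g0.0 = g0 and \<phi> = \<phi>' and ?\<mu>0.0 = \<mu>0
          and a = "a - \<mu>0" and b = "b - \<mu>0", OF pos cont' supp' zero']
      have "T_loc \<mu>0 ?f0 g0 = (\<lambda>x. - (\<phi>' (x - \<mu>0) / g0 (x - \<mu>0)))"
        using pair(2) by (intro ext) simp
      moreover have "has_bochner_integral P (T_loc \<mu>0 ?f0 g0) 0"
        using pair(1) by (intro stein) simp
      ultimately show ?thesis by simp
    qed
    from has_bochner_integral_minus[OF this]
    have "has_bochner_integral P (\<lambda>x. inverse (g x) *\<^sub>R \<phi> x) 0"
      by (simp add: \<phi>'_def g_def divide_inverse mult.commute)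
    then show "has_bochner_integral N \<phi> 0"
      unfolding N_def using gpos
      by (intro has_bochner_integral_density) (auto simp: less_imp_le)
  qed
  then obtain c where c: "N = density lborel (\<lambda>_. ennreal c)" by blast
  have "P = density P (\<lambda>x. ennreal (inverse (g x)) * ennreal (g x))"
  proof -
    have "ennreal (inverse (g x)) * ennreal (g x) = 1" for x
      using gpos[of x] by (simp add: ennreal_mult[symmetric] less_imp_le)
    then show ?thesis by (simp add: density_1)
  qed
  also have "\<dots> = density N (\<lambda>x. ennreal (g x))"
    unfolding N_def by (rule density_density_eq[symmetric]) auto
  also have "\<dots> = density lborel (\<lambda>x. ennreal c * ennreal (g x))"
    unfolding c by (rule density_density_eq) auto
  finally have Pc: "P = density lborel (\<lambda>x. ennreal c * ennreal (g x))" .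
  have total: "(\<integral>\<^sup>+x. ennreal (g x) \<partial>lborel) = 1"
  proof -
    have "has_bochner_integral lborel g 1"
    proof -
      have "loc_model g0 \<in> G_dens \<mu>0" using g0 by (simp add: G_loc_def)
      then show ?thesis by (auto simp: G_dens_def loc_model_def g_def[abs_def])
    qed
    then show ?thesis
      using gpos by (subst nn_integral_eq_integral) (auto simp: has_bochner_integral_iff less_imp_le)
  qed
  have "1 = emeasure P (space P)"
    using prob_space.emeasure_space_1[OF P] by simp
  also have "\<dots> = ennreal c * (\<integral>\<^sup>+x. ennreal (g x) \<partial>lborel)"
    by (subst Pc, subst Pc) (simp add: emeasure_density nn_integral_cmult)
  finally have "ennreal c = 1" using total by simp
  then show ?thesis using Pc by (simp add: g_def)
qed

text \<open>The supports for different parameters are translates of each other. If they coincide, the common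
support is a translation invariant set, and it is not empty because \<open>g0\<close> has integral \<open>1\<close>.\<close>
lemma translation_invariant_support:
  assumes g0: "g0 \<in> G_loc \<mu>0" and S: "\<And>\<mu>. dens_support (\<lambda>x. loc_model g0 x \<mu>) = S"
  shows "0 < g0 x" and "S = UNIV"
proof -
  have nonneg: "0 \<le> g0 x" for x using g0 by (auto simp: G_loc_def)
  have "\<exists>z. 0 < g0 z"
  proof (rule ccontr)
    assume "\<nexists>z. 0 < g0 z"
    then have "g0 z = 0" for z using nonneg[of z] by (metis less_eq_real_def)
    then show False using g0 by (auto simp: G_loc_def has_bochner_integral_iff)
  qed
  then obtain z where z: "0 < g0 z" by blast
  have y: "y \<in> S" for y
    using S[of "y - z"] z by (auto simp: dens_support_def loc_model_def)
  then show "S = UNIV" by auto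
  show "0 < g0 x"
    using y[of x] S[of 0] by (auto simp: dens_support_def loc_model_def)
qed

theorem corollary2p1:
  fixes \<mu>0 :: real and g0 :: "real \<Rightarrow> real"
    and N :: "real \<Rightarrow> 'b measure" and Z :: "real \<Rightarrow> 'b \<Rightarrow> real"
    and M :: "'a measure" and X :: "'a \<Rightarrow> real"
  assumes "g0 \<in> G_loc \<mu>0"
    and "\<And>\<mu>. prob_space (N \<mu>)"
    and "\<And>\<mu>. distributed (N \<mu>) lborel (Z \<mu>) (\<lambda>x. ennreal (loc_model g0 x \<mu>))"
    and "prob_space M" and "X \<in> borel_measurable M"
  shows "(eq_law M X (N \<mu>0) (Z \<mu>0) \<longrightarrow>
            (\<forall>f0 \<in> F_loc g0 \<mu>0. has_bochner_integral M (\<lambda>\<omega>. T_loc \<mu>0 f0 g0 (X \<omega>)) 0)) \<and>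
         (\<forall>S. (\<forall>\<mu>. dens_support (\<lambda>x. loc_model g0 x \<mu>) = S) \<and>
            (\<forall>f0 \<in> F_loc g0 \<mu>0. has_bochner_integral M (\<lambda>\<omega>. T_loc \<mu>0 f0 g0 (X \<omega>)) 0) \<longrightarrow>
            eq_law (cond_measure M X S) X (N \<mu>0) (Z \<mu>0))"
proof -
  interpret M: prob_space M by fact
  have [measurable]: "X \<in> borel_measurable M" by fact
  have law_Z: "distr (N \<mu>0) borel (Z \<mu>0) = density lborel (\<lambda>x. ennreal (g0 (x - \<mu>0)))"
  proof -
    have "distr (N \<mu>0) borel (Z \<mu>0) = distr (N \<mu>0) lborel (Z \<mu>0)"
      by (rule distr_cong) auto
    also have "\<dots> = density lborel (\<lambda>x. ennreal (g0 (x - \<mu>0)))"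
      using distributed_distr_eq_density[OF assms(3)[of \<mu>0]] by (simp add: loc_model_def)
    finally show ?thesis .
  qed
  have transfer: "has_bochner_integral M (\<lambda>\<omega>. T_loc \<mu>0 f0 g0 (X \<omega>)) 0 \<longleftrightarrow>
      has_bochner_integral (distr M borel X) (T_loc \<mu>0 f0 g0) 0" if "f0 \<in> F_loc g0 \<mu>0" for f0
    using T_loc_expectation_zero(1)[OF assms(1) that]
    by (simp add: has_bochner_integral_iff integrable_distr_eq integral_distr)
  show ?thesis
  proof (intro conjI allI impI ballI)
    fix f0 assume law: "eq_law M X (N \<mu>0) (Z \<mu>0)" and f0: "f0 \<in> F_loc g0 \<mu>0"
    have "distr M borel X = density lborel (\<lambda>x. ennreal (g0 (x - \<mu>0)))"
      using law law_Z by (simp add: eq_law_def)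
    then show "has_bochner_integral M (\<lambda>\<omega>. T_loc \<mu>0 f0 g0 (X \<omega>)) 0"
      using T_loc_expectation_zero(2)[OF assms(1) f0] transfer[OF f0] by simp
  next
    fix S
    assume *: "(\<forall>\<mu>. dens_support (\<lambda>x. loc_model g0 x \<mu>) = S) \<and>
      (\<forall>f0 \<in> F_loc g0 \<mu>0. has_bochner_integral M (\<lambda>\<omega>. T_loc \<mu>0 f0 g0 (X \<omega>)) 0)"
    then have S: "\<And>\<mu>. dens_support (\<lambda>x. loc_model g0 x \<mu>) = S" by blast
    have "distr M borel X = density lborel (\<lambda>x. ennreal (g0 (x - \<mu>0)))"
    proof (rule density_from_stein_identities)
      show "prob_space (distr M borel X)" by (rule M.prob_space_distr) auto
      show "0 < g0 x" for x by (rule translation_invariant_support(1)[OF assms(1) S])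
      show "has_bochner_integral (distr M borel X) (T_loc \<mu>0 f0 g0) 0" if "f0 \<in> F_loc g0 \<mu>0" for f0
        using * that transfer by blast
    qed (use assms in auto)
    \<comment> \<open>As \<open>S\<close> is the whole line, the conditioning event is certain.\<close>
    moreover have "cond_measure M X S = M"
    proof (rule measure_eqI)
      show "sets (cond_measure M X S) = sets M" by (simp add: cond_measure_def)
      fix A assume "A \<in> sets (cond_measure M X S)"
      then have A: "A \<in> sets M" by (simp add: cond_measure_def)
      have "{\<omega> \<in> space M. X \<omega> \<in> S} = space M"
        using translation_invariant_support(2)[OF assms(1) S] by simp
      then show "emeasure (cond_measure M X S) A = emeasure M A"
        using A by (simp add: cond_measure_def emeasure_uniform_measure M.emeasure_space_1 Int_absorb1
            sets.sets_into_space divide_ennreal_def)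
    qed
    ultimately show "eq_law (cond_measure M X S) X (N \<mu>0) (Z \<mu>0)"
      by (simp add: eq_law_def law_Z)
  qed
qed

end
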